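(* Let $E$ be an arbitrary graph and let $K$ be any field. Then the following properties are equivalent: (i) $L_K(E)$ is a Zorn ring. (ii) Every non-zero right ideal and every non-zero left ideal of $L_K(E)$ contains a non-zero idempotent. (iii) For every non-zero $a \in L_K(E)$ there is a non-zero $b \in L_K(E)$ such that $bab = b$. (iv) The graph $E$ satisfies Condition (L).
   Context: Rings are associative and need not have an identity. A ring $R$ is a Zorn ring if for every $a \in R$, either $a$ is nilpotent or there is $b \in R$ such that $ab$ is a non-zero idempotent. A (directed) graph $E = (E^0, E^1, r, s)$ consists of two sets $E^0$ (vertices) and $E^1$ (edges) and maps $r, s : E^1 \to E^0$. No restriction is placed on the number of vertices or on the number of edges emitted by a vertex. A vertex $v$ is regular if $s^{-1}(v)$ is finite and non-empty. A path is a finite sequence of edges $\mu = e_1 \cdots e_n$ ($n \ge 1$) with $r(e_i) = s(e_{i+1})$ for $1 \le i \le n-1$. It is closed if $r(e_n) = s(e_1)$ (and is then said to be based at $s(e_1)$), and a closed path is simple if $s(e_i) \ne s(e_1)$ for all $i = 2, \dots, n$. An exit for a path $\mu = e_1 \cdots e_n$ is an edge $e$ such that $s(e) = s(e_i)$ and $e \neq e_i$ for some $i$. The graph $E$ satisfies Condition (L) if every simple closed path in $E$ has an exit. The Leavitt path algebra $L_K(E)$ is the $K$-algebra generated by a set $\{v : v \in E^0\}$ of pairwise orthogonal idempotents together with a set of variables $\{e, e^* : e \in E^1\}$ subject to the relations: (1) $s(e)e = e = e\,r(e)$ for all $e \in E^1$; (2) $r(e)e^* = e^* = e^* s(e)$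 for all $e \in E^1$; (3) for all $e, f \in E^1$, $e^*e = r(e)$ and $e^* f = 0$ if $e \ne f$; (4) $v = \sum_{e \in E^1, s(e) = v} e e^*$ for every regular vertex $v$. *)

theory Defs
  imports
    "HOL-Algebra.QuotRing"
    "HOL-Library.Poly_Mapping"
    "Graph_Theory.Digraph"
    "Graph_Theory.Arc_Walk"
begin

section \<open>Rings without identity\<close>

text \<open>
  We reuse the ring records of HOL-Algebra. Nothing is assumed about the field
  \<^const>\<open>one\<close>, and no notion below refers to it. In particular the operation
  \<^const>\<open>pow\<close>, whose recursion starts at \<^const>\<open>one\<close>, must not be used for powers.
\<close>

locale nonunital_ring = abelian_group R for R (structure) +
  assumes rng_mult_closed:
      "\<lbrakk>x \<in> carrier R; y \<in> carrier R\<rbrakk> \<Longrightarrow> x \<otimes> y \<in> carrier R"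
    and rng_mult_assoc:
      "\<lbrakk>x \<in> carrier R; y \<in> carrier R; z \<in> carrier R\<rbrakk> \<Longrightarrow> (x \<otimes> y) \<otimes> z = x \<otimes> (y \<otimes> z)"
    and rng_distrib_right:
      "\<lbrakk>x \<in> carrier R; y \<in> carrier R; z \<in> carrier R\<rbrakk> \<Longrightarrow> (x \<oplus> y) \<otimes> z = x \<otimes> z \<oplus> y \<otimes> z"
    and rng_distrib_left:
      "\<lbrakk>x \<in> carrier R; y \<in> carrier R; z \<in> carrier R\<rbrakk> \<Longrightarrow> z \<otimes> (x \<oplus> y) = z \<otimes> x \<oplus> z \<otimes> y"

definition idempotent_elem :: "('a, 'b) ring_scheme \<Rightarrow> 'a \<Rightarrow> bool" where
  "idempotent_elem R x \<longleftrightarrow> x \<in> carrier R \<and> x \<otimes>\<^bsub>R\<^esub> x = x"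

text \<open>\<open>pow_Suc R a n\<close> is the power of \<open>a\<close> with exponent \<open>n + 1\<close>.\<close>

primrec pow_Suc :: "('a, 'b) ring_scheme \<Rightarrow> 'a \<Rightarrow> nat \<Rightarrow> 'a" where
  "pow_Suc R a 0 = a"
| "pow_Suc R a (Suc n) = pow_Suc R a n \<otimes>\<^bsub>R\<^esub> a"

definition nilpotent_elem :: "('a, 'b) ring_scheme \<Rightarrow> 'a \<Rightarrow> bool" where
  "nilpotent_elem R a \<longleftrightarrow> a \<in> carrier R \<and> (\<exists>n. pow_Suc R a n = \<zero>\<^bsub>R\<^esub>)"

locale zorn_ring = nonunital_ring +
  assumes zorn: "a \<in> carrier R \<Longrightarrow>
    nilpotent_elem R a \<or> (\<exists>b\<in>carrier R. idempotent_elem R (a \<otimes> b) \<and> a \<otimes> b \<noteq> \<zero>)"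

locale left_ideal = additive_subgroup I R for I and R (structure) +
  assumes left_ideal_closed: "\<lbrakk>x \<in> carrier R; a \<in> I\<rbrakk> \<Longrightarrow> x \<otimes> a \<in> I"

locale right_ideal = additive_subgroup I R for I and R (structure) +
  assumes right_ideal_closed: "\<lbrakk>a \<in> I; x \<in> carrier R\<rbrakk> \<Longrightarrow> a \<otimes> x \<in> I"

section \<open>Condition (L)\<close>

text \<open>
  For a \<^locale>\<open>wf_digraph\<close>, \<^const>\<open>tail\<close> and \<^const>\<open>head\<close> are the source and the range map.
  Loops, parallel edges, infinitely many vertices and infinite emitters are all
  allowed.
\<close>

definition regular_vertex :: "('v, 'e) pre_digraph \<Rightarrow> 'v \<Rightarrow> bool" where
  "regular_vertex E v \<longleftrightarrow> v \<in> verts E \<and> finite (out_arcs E v) \<and> out_arcs E v \<noteq> {}"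

text \<open>
  A simple closed path does not return to its base vertex before its end, but it may
  visit other vertices repeatedly; this is weaker than \<^const>\<open>pre_digraph.cycle\<close>.
\<close>

definition simple_closed_path :: "('v, 'e) pre_digraph \<Rightarrow> 'e list \<Rightarrow> bool" where
  "simple_closed_path E p \<longleftrightarrow>
     p \<noteq> [] \<and> (\<exists>v. pre_digraph.awalk E v p v) \<and>
     (\<forall>e\<in>set (tl p). tail E e \<noteq> tail E (hd p))"

definition is_exit :: "('v, 'e) pre_digraph \<Rightarrow> 'e \<Rightarrow> 'e list \<Rightarrow> bool" where
  "is_exit E e p \<longleftrightarrow> e \<in> arcs E \<and> (\<exists>f\<in>set p. tail E e = tail E f \<and> e \<noteq> f)"

definition condition_L :: "('v, 'e) pre_digraph \<Rightarrow> bool" where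
  "condition_L E \<longleftrightarrow> (\<forall>p. simple_closed_path E p \<longrightarrow> (\<exists>e. is_exit E e p))"

section \<open>Free algebras\<close>

text \<open>
  Words form a monoid under concatenation. Hence the finitely supported functions from
  words to a field, with the convolution product of HOL-Library.Poly_Mapping, form the
  free unital algebra. The wrapper is needed because HOL-Library.ListVector declares a
  pointwise addition of lists.
\<close>

datatype 'a free_word = FWord (letters: "'a list")

instantiation free_word :: (type) monoid_add
begin

definition "0 = FWord []"
definition "u + v = FWord (letters u @ letters v)"

instance
  by standard (auto simp: zero_free_word_def plus_free_word_def)

end

text \<open>
  The free algebra without identity on a set \<open>X\<close> of generators: the words that occur
  are non-empty. The field \<^const>\<open>one\<close> is a dummy.
\<close>

definition free_rng :: "'a set \<Rightarrow> ('a free_word \<Rightarrow>\<^sub>0 'k::field) ring" where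
  "free_rng X =
     \<lparr>carrier = {x. \<forall>w\<in>Poly_Mapping.keys x. letters w \<noteq> [] \<and> set (letters w) \<subseteq> X},
      monoid.mult = (*), one = undefined, ring.zero = 0, add = (+)\<rparr>"

definition gen :: "'a \<Rightarrow> 'a free_word \<Rightarrow>\<^sub>0 'k::field" where
  "gen x = Poly_Mapping.single (FWord [x]) 1"

text \<open>
  The algebra ideal generated by \<open>S\<close>. Without an identity, closure under
  multiplication does not give closure under scalars; \<open>single 0 c * x\<close> is the scalar
  multiple of \<open>x\<close> by \<open>c\<close>, because \<open>0\<close> is the empty word.
\<close>

inductive_set alg_ideal ::
    "'a set \<Rightarrow> ('a free_word \<Rightarrow>\<^sub>0 'k::field) set \<Rightarrow> ('a free_word \<Rightarrow>\<^sub>0 'k) set"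
  for X S where
  base: "x \<in> S \<Longrightarrow> x \<in> alg_ideal X S"
| zero: "0 \<in> alg_ideal X S"
| add: "x \<in> alg_ideal X S \<Longrightarrow> y \<in> alg_ideal X S \<Longrightarrow> x + y \<in> alg_ideal X S"
| scale: "x \<in> alg_ideal X S \<Longrightarrow> Poly_Mapping.single 0 c * x \<in> alg_ideal X S"
| mult_left:
    "x \<in> alg_ideal X S \<Longrightarrow> y \<in> carrier (free_rng X) \<Longrightarrow> y * x \<in> alg_ideal X S"
| mult_right:
    "x \<in> alg_ideal X S \<Longrightarrow> y \<in> carrier (free_rng X) \<Longrightarrow> x * y \<in> alg_ideal X S"

section \<open>Leavitt path algebras\<close>

datatype ('v, 'e) lpa_gen = Vertex 'v | Edge 'e | Ghost 'e

definition lpa_gens :: "('v, 'e) pre_digraph \<Rightarrow> ('v, 'e) lpa_gen set" where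
  "lpa_gens E = Vertex ` verts E \<union> Edge ` arcs E \<union> Ghost ` arcs E"

inductive_set lpa_relators ::
    "('v, 'e) pre_digraph \<Rightarrow> (('v, 'e) lpa_gen free_word \<Rightarrow>\<^sub>0 'k::field) set"
  for E where
  vertex_idem: "v \<in> verts E \<Longrightarrow>
    gen (Vertex v) * gen (Vertex v) - gen (Vertex v) \<in> lpa_relators E"
| vertex_orth: "v \<in> verts E \<Longrightarrow> w \<in> verts E \<Longrightarrow> v \<noteq> w \<Longrightarrow>
    gen (Vertex v) * gen (Vertex w) \<in> lpa_relators E"
| source_edge: "e \<in> arcs E \<Longrightarrow>
    gen (Vertex (tail E e)) * gen (Edge e) - gen (Edge e) \<in> lpa_relators E"
| edge_range: "e \<in> arcs E \<Longrightarrow>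
    gen (Edge e) * gen (Vertex (head E e)) - gen (Edge e) \<in> lpa_relators E"
| range_ghost: "e \<in> arcs E \<Longrightarrow>
    gen (Vertex (head E e)) * gen (Ghost e) - gen (Ghost e) \<in> lpa_relators E"
| ghost_source: "e \<in> arcs E \<Longrightarrow>
    gen (Ghost e) * gen (Vertex (tail E e)) - gen (Ghost e) \<in> lpa_relators E"
| ghost_edge_same: "e \<in> arcs E \<Longrightarrow>
    gen (Ghost e) * gen (Edge e) - gen (Vertex (head E e)) \<in> lpa_relators E"
| ghost_edge_diff: "e \<in> arcs E \<Longrightarrow> f \<in> arcs E \<Longrightarrow> e \<noteq> f \<Longrightarrow>
    gen (Ghost e) * gen (Edge f) \<in> lpa_relators E"
| regular: "regular_vertex E v \<Longrightarrow>
    gen (Vertex v) - (\<Sum>e\<in>out_arcs E v. gen (Edge e) * gen (Ghost e)) \<in> lpa_relators E"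

definition leavitt_path_algebra ::
    "'k::field itself \<Rightarrow> ('v, 'e) pre_digraph \<Rightarrow>
     (('v, 'e) lpa_gen free_word \<Rightarrow>\<^sub>0 'k) set ring" where
  "leavitt_path_algebra _ E =
     free_rng (lpa_gens E) Quot alg_ideal (lpa_gens E) (lpa_relators E)"


text \<open>The quotient is indeed a ring.\<close>

lemma mult_mem_free_rng:
  fixes x y :: "'a free_word \<Rightarrow>\<^sub>0 'k::field"
  assumes "x \<in> carrier (free_rng X)" "y \<in> carrier (free_rng X)"
  shows "x * y \<in> carrier (free_rng X)"
proof -
  have "letters w \<noteq> [] \<and> set (letters w) \<subseteq> X" if "w \<in> Poly_Mapping.keys (x * y)" for w
  proof -
    from that obtain u v where "w = u + v" "u \<in> Poly_Mapping.keys x" "v \<in> Poly_Mapping.keys y"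
      using keys_mult[of x y] by blast
    then show ?thesis
      using assms by (auto simp: free_rng_def plus_free_word_def)
  qed
  then show ?thesis by (auto simp: free_rng_def)
qed

lemma free_rng_simps [simp]:
  "mult (free_rng X) = (*)" "add (free_rng X) = (+)" "zero (free_rng X) = 0"
  by (simp_all add: free_rng_def)

lemma zero_mem_free_rng: "0 \<in> carrier (free_rng X)"
  by (simp add: free_rng_def)

lemma uminus_mem_free_rng:
  "x \<in> carrier (free_rng X) \<Longrightarrow> - x \<in> carrier (free_rng X)"
  by (auto simp: free_rng_def keys_def)

lemma plus_mem_free_rng:
  "x \<in> carrier (free_rng X) \<Longrightarrow> y \<in> carrier (free_rng X) \<Longrightarrow> x + y \<in> carrier (free_rng X)"
  using keys_add[of x y] by (auto simp: free_rng_def)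

lemma nonunital_ring_free_rng: "nonunital_ring (free_rng X :: ('a free_word \<Rightarrow>\<^sub>0 'k::field) ring)"
proof (intro nonunital_ring.intro nonunital_ring_axioms.intro abelian_groupI)
  fix x :: "'a free_word \<Rightarrow>\<^sub>0 'k"
  assume "x \<in> carrier (free_rng X)"
  then show "\<exists>y\<in>carrier (free_rng X). y \<oplus>\<^bsub>free_rng X\<^esub> x = \<zero>\<^bsub>free_rng X\<^esub>"
    by (intro bexI[of _ "- x"]) (auto simp: uminus_mem_free_rng)
qed (auto simp: mult_mem_free_rng plus_mem_free_rng algebra_simps, simp add: free_rng_def)


lemma gen_mem_free_rng: "x \<in> X \<Longrightarrow> gen x \<in> carrier (free_rng X)"
  by (auto simp: gen_def free_rng_def)

lemma diff_mem_free_rng: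
  "x \<in> carrier (free_rng X) \<Longrightarrow> y \<in> carrier (free_rng X) \<Longrightarrow> x - y \<in> carrier (free_rng X)"
  using plus_mem_free_rng[of x X "- y"] uminus_mem_free_rng[of y X] by simp

lemma sum_mem_free_rng:
  "(\<And>i. i \<in> A \<Longrightarrow> f i \<in> carrier (free_rng X)) \<Longrightarrow> sum f A \<in> carrier (free_rng X)"
  by (induction A rule: infinite_finite_induct)
    (auto intro: plus_mem_free_rng zero_mem_free_rng)

lemma scale_mem_free_rng:
  assumes "x \<in> carrier (free_rng X)"
  shows "Poly_Mapping.single 0 c * x \<in> carrier (free_rng X)"
proof -
  have "w \<in> Poly_Mapping.keys x" if "w \<in> Poly_Mapping.keys (Poly_Mapping.single 0 c * x)" for w
  proof -
    from that obtain u v where "w = u + v" "u \<in> Poly_Mapping.keys (Poly_Mapping.single 0 c)"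
        "v \<in> Poly_Mapping.keys x"
      using keys_mult[of "Poly_Mapping.single 0 c" x] by blast
    then show ?thesis by (simp split: if_splits)
  qed
  then show ?thesis using assms by (auto simp: free_rng_def)
qed

lemma lpa_relators_subset:
  assumes "wf_digraph E"
  shows "lpa_relators E \<subseteq> carrier (free_rng (lpa_gens E))"
proof
  interpret wf_digraph E by fact
  fix x :: "('a, 'b) lpa_gen free_word \<Rightarrow>\<^sub>0 'c"
  assume "x \<in> lpa_relators E"
  then show "x \<in> carrier (free_rng (lpa_gens E))"
    by cases
      (auto intro!: diff_mem_free_rng sum_mem_free_rng mult_mem_free_rng gen_mem_free_rng
        simp: lpa_gens_def regular_vertex_def)
qed

lemma alg_ideal_subset:
  assumes "S \<subseteq> carrier (free_rng X)"
  shows "alg_ideal X S \<subseteq> carrier (free_rng X)"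
proof
  fix x assume "x \<in> alg_ideal X S"
  then show "x \<in> carrier (free_rng X)"
    by induction
      (use assms in \<open>auto intro: plus_mem_free_rng mult_mem_free_rng scale_mem_free_rng
        zero_mem_free_rng\<close>)
qed

lemma uminus_mem_alg_ideal:
  assumes "x \<in> alg_ideal X S"
  shows "- x \<in> alg_ideal X S"
proof -
  have "Poly_Mapping.single 0 (- 1) * x = - x"
    by (simp add: single_uminus)
  then show ?thesis using alg_ideal.scale[OF assms, of "- 1"] by simp
qed

lemma (in nonunital_ring) nonunital_ring_Quot:
  assumes "left_ideal I R" and "right_ideal I R"
  shows "nonunital_ring (R Quot I)"
proof -
  interpret L: left_ideal I R by fact
  interpret R: right_ideal I R by fact
  interpret abelian_subgroup I R
    by (rule abelian_subgroupI3[OF L.additive_subgroup_axioms abelian_group_axioms])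
  have mult: "rcoset_mult R I (I +> x) (I +> y) = I +> (x \<otimes> y)"
    if xy: "x \<in> carrier R" "y \<in> carrier R" for x y
  proof -
    have eq: "I +> (a \<otimes> b) = I +> (x \<otimes> y)" if ab: "a \<in> I +> x" "b \<in> I +> y" for a b
    proof -
      obtain i j where ij: "i \<in> I" "j \<in> I" "a = i \<oplus> x" "b = j \<oplus> y"
        using ab unfolding a_r_coset_def' by blast
      note [simp] = xy L.a_Hcarr[OF ij(1)] L.a_Hcarr[OF ij(2)] rng_mult_closed
      have "a \<otimes> b = (i \<otimes> j \<oplus> i \<otimes> y \<oplus> x \<otimes> j) \<oplus> x \<otimes> y"
        by (simp add: ij rng_distrib_left rng_distrib_right a_ac)
      moreover have "i \<otimes> j \<oplus> i \<otimes> y \<oplus> x \<otimes> j \<in> I"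
        using ij by (intro L.a_closed R.right_ideal_closed L.left_ideal_closed) simp_all
      ultimately have "a \<otimes> b \<in> I +> (x \<otimes> y)"
        unfolding a_r_coset_def' by blast
      then show ?thesis
        using xy by (intro a_repr_independence'[symmetric]) (simp_all)
    qed
    have "x \<in> I +> x" "y \<in> I +> y"
      using xy a_rcos_self by blast+
    moreover have "rcoset_mult R I (I +> x) (I +> y) =
        (\<Union>a\<in>I +> x. \<Union>b\<in>I +> y. I +> (x \<otimes> y))"
      unfolding rcoset_mult_def by (intro SUP_cong refl eq)
    ultimately show ?thesis by (metis SUP_const empty_iff)
  qed
  show ?thesis
  proof (intro nonunital_ring.intro nonunital_ring_axioms.intro)
    show "abelian_group (R Quot I)"
      by (rule comm_group_abelian_groupI)
        (simp add: FactRing_def a_factorgroup_is_comm_group[unfolded A_FactGroup_def'])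
  qed (auto simp: FactRing_simps mult a_rcos_sum rng_mult_assoc rng_distrib_left
      rng_distrib_right rng_mult_closed a_closed)
qed

lemma nonunital_ring_leavitt_path_algebra:
  assumes "wf_digraph E"
  shows "nonunital_ring (leavitt_path_algebra TYPE('k::field) E)"
proof -
  define X where "X = lpa_gens E"
  define I :: "(('a, 'b) lpa_gen free_word \<Rightarrow>\<^sub>0 'k) set"
    where "I = alg_ideal X (lpa_relators E)"
  interpret F: nonunital_ring "free_rng X :: (('a, 'b) lpa_gen free_word \<Rightarrow>\<^sub>0 'k) ring"
    by (rule nonunital_ring_free_rng)
  have sub: "I \<subseteq> carrier (free_rng X)"
    unfolding I_def X_def by (intro alg_ideal_subset lpa_relators_subset assms)
  have inv: "\<ominus>\<^bsub>free_rng X\<^esub> x = - x" if "x \<in> I" for x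
    using that sub uminus_mem_free_rng by (intro F.minus_equality) auto
  have "additive_subgroup I (free_rng X)"
  proof (intro additive_subgroup.intro F.add.subgroupI)
    show "I \<noteq> {}" using alg_ideal.zero unfolding I_def by blast
    show "\<ominus>\<^bsub>free_rng X\<^esub> x \<in> I" if "x \<in> I" for x
      using inv[OF that] uminus_mem_alg_ideal that by (auto simp: I_def)
  qed (use sub in \<open>auto simp: I_def intro: alg_ideal.add\<close>)
  then have "left_ideal I (free_rng X)" "right_ideal I (free_rng X)"
    by (auto simp: left_ideal_def right_ideal_def left_ideal_axioms_def right_ideal_axioms_def
        I_def intro: alg_ideal.mult_left alg_ideal.mult_right)
  then show ?thesis
    unfolding leavitt_path_algebra_def X_def[symmetric] I_def[symmetric]
    by (rule F.nonunital_ring_Quot)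
qed

end

theory Submission
  imports
    Defs
    "HOL-Library.Function_Algebras"
    "HOL-Library.Sublist"
    "HOL-Computational_Algebra.Polynomial"
begin

text \<open>
  Write \<open>L\<close> for the Leavitt path algebra of \<open>E\<close>. The implications are proved in the
  cycle (iv) to (iii) to (ii) to (i) to (iv).

  Two steps hold in every ring. If \<open>b a b = b \<noteq> 0\<close>, then \<open>a b\<close> and \<open>b a\<close> are non-zero
  idempotents, so that (iii) puts non-zero idempotents into all non-zero one-sided ideals; and an
  element \<open>a\<close> with \<open>a a \<noteq> 0\<close> has a non-zero right ideal \<open>a R\<close>, whose idempotents
  have the form \<open>a b\<close>, so that (ii) gives the Zorn property.

  For (iv) to (iii) the essential fact is the reduction theorem \<open>reduction\<close>: under
  Condition (L), every \<open>a \<noteq> 0\<close> in \<open>L\<close> admits \<open>x, y\<close> such that \<open>x a y\<close> is a vertex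
  \<open>v\<close>. Then \<open>b = y v x\<close> satisfies \<open>b a b = b\<close>, and \<open>b \<noteq> 0\<close> because vertices are
  non-zero. The reduction has two stages. Right multiplication by edges removes the ghost edges of
  \<open>a\<close>, until a combination of paths with a common end remains (\<open>reduce_to_path_combination\<close>).
  Cancelling a shortest one of these paths leaves \<open>k w\<close> plus a combination of closed paths
  \<open>t\<close> at a vertex \<open>w\<close>, and conjugating by a path \<open>q\<close> kills each \<open>t\<close> for which
  \<open>q\<close> is not a prefix of \<open>t q\<close>. Such a \<open>q\<close> exists (\<open>escaping_walk\<close>): go round a
  shortest closed path at \<open>w\<close> sufficiently often and then leave it through an exit.

  For (i) to (iv), let \<open>c\<close> be a simple closed path at \<open>v\<close> without an exit. Then \<open>v L v\<close> is
  the ring of Laurent polynomials in \<open>c\<close>, with identity \<open>v\<close>, and \<open>a = v - c\<close> contradicts the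
  Zorn property. It is not nilpotent, since \<open>(1 - X) ^ n \<noteq> 0\<close>. If \<open>e = a b\<close> is idempotent,
  then \<open>e v\<close> is an idempotent of the domain \<open>v L v\<close>, hence \<open>0\<close> or \<open>v\<close>; being a
  multiple of \<open>v - c\<close> it vanishes at \<open>c = 1\<close>, and so it is \<open>0\<close>. This
  is \<open>witness_no_idempotent\<close>.

  Two representations support these arguments. The quotient ring \<open>L\<close> consists of cosets. The
  regular representation \<open>quotient_embeds_in_endo\<close> embeds it into a ring of additive
  endomorphisms, which is an instance of \<^class>\<open>ring_1\<close>, so that computations take place in a
  type rather than on a carrier. And the representation of \<open>L\<close> on functions of boundary paths, with
  an integer degree attached, shows that vertices are non-zero (\<open>vertex_nonzero\<close>) and that the
  powers of a cycle are linearly independent (\<open>cycle_powers_independent\<close>).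
\<close>

section \<open>Additive endomorphisms as a ring type\<close>

text \<open>
  Two modules occur below: the free algebra, for the regular representation, and the functions on
  boundary paths. The sort asks for \<open>0 \<noteq> 1\<close> in the module only to make it non-trivial, as
  \<^class>\<open>ring_1\<close> demands \<open>0 \<noteq> 1\<close> of its endomorphism ring.
\<close>

typedef (overloaded) 'm endo = "{f :: 'm::{ab_group_add, zero_neq_one} \<Rightarrow> 'm. \<forall>x y. f (x + y) = f x + f y}"
  morphisms app Endo
  by (rule exI[of _ id]) simp

setup_lifting type_definition_endo

instantiation endo :: ("{ab_group_add, zero_neq_one}") ring_1
begin

lift_definition zero_endo :: "'a endo" is "\<lambda>x. 0" by simp
lift_definition one_endo :: "'a endo" is "\<lambda>x. x" by simp
lift_definition plus_endo :: "'a endo \<Rightarrow> 'a endo \<Rightarrow> 'a endo" is "\<lambda>f h x. f x + h x"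
  by (simp add: algebra_simps)
lift_definition uminus_endo :: "'a endo \<Rightarrow> 'a endo" is "\<lambda>f x. - f x" by simp
lift_definition minus_endo :: "'a endo \<Rightarrow> 'a endo \<Rightarrow> 'a endo" is "\<lambda>f h x. f x - h x"
  by (simp add: algebra_simps)
lift_definition times_endo :: "'a endo \<Rightarrow> 'a endo \<Rightarrow> 'a endo" is "\<lambda>f h x. f (h x)"
  by simp

instance
proof
  show "(0 :: 'a endo) \<noteq> 1" by transfer (metis zero_neq_one)
qed (transfer; simp add: fun_eq_iff algebra_simps)+

end

lemma app_simps [simp]:
  "app 0 x = 0" "app 1 x = x" "app (f + h) x = app f x + app h x"
  "app (- f) x = - app f x" "app (f - h) x = app f x - app h x"
  "app (f * h) x = app f (app h x)"
  by (transfer; simp)+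

lemma app_Endo: "(\<And>x y. f (x + y) = f x + f y) \<Longrightarrow> app (Endo f) = f"
  by (simp add: Endo_inverse)

lemma app_sum: "app (sum f A) x = (\<Sum>i\<in>A. app (f i) x)"
  by (induction A rule: infinite_finite_induct) auto

lemma endo_eqI: "(\<And>x. app f x = app h x) \<Longrightarrow> f = h"
  by transfer auto

section \<open>Evaluation of the free algebra\<close>

lemma sum_single_lookup:
  fixes x :: "'b \<Rightarrow>\<^sub>0 'c::comm_monoid_add"
  shows "(\<Sum>w\<in>Poly_Mapping.keys x. Poly_Mapping.single w (Poly_Mapping.lookup x w)) = x"
  by (rule poly_mapping_eqI)
    (auto simp: lookup_sum lookup_single when_def not_in_keys_iff_lookup_eq_zero)

text \<open>
  The data of a homomorphism from the free algebra to a ring: images of the generators, and a ring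
  homomorphism \<open>sc\<close> from the field whose values commute with them. Giving \<open>sc\<close>
  separately makes the target an algebra over the field without a type for such algebras.
\<close>

locale generator_assignment =
  fixes sc :: "'k::field \<Rightarrow> 'r::ring_1" and g :: "'a \<Rightarrow> 'r"
  assumes sc_add: "sc (a + b) = sc a + sc b"
    and sc_mult: "sc (a * b) = sc a * sc b"
    and sc_one [simp]: "sc 1 = 1"
    and sc_central: "sc a * g x = g x * sc a"
begin

definition word_value :: "'a free_word \<Rightarrow> 'r" where
  "word_value w = prod_list (map g (letters w))"

definition eval :: "('a free_word \<Rightarrow>\<^sub>0 'k) \<Rightarrow> 'r" where
  "eval x = (\<Sum>w\<in>Poly_Mapping.keys x. sc (Poly_Mapping.lookup x w) * word_value w)"

lemma sc_zero [simp]: "sc 0 = 0"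
  using sc_add[of 0 0] by simp

lemma sc_uminus: "sc (- a) = - sc a"
  using sc_add[of a "- a"] by (simp add: eq_neg_iff_add_eq_0 add.commute)

lemma word_value_zero [simp]: "word_value 0 = 1"
  by (simp add: word_value_def zero_free_word_def)

lemma word_value_add: "word_value (u + v) = word_value u * word_value v"
  by (simp add: word_value_def plus_free_word_def)

lemma sc_word_value: "sc a * word_value w = word_value w * sc a"
proof -
  have "sc a * prod_list (map g xs) = prod_list (map g xs) * sc a" for xs
  proof (induction xs)
    case (Cons x xs)
    have "sc a * (g x * prod_list (map g xs)) = g x * (sc a * prod_list (map g xs))"
      by (metis sc_central mult.assoc)
    then show ?case using Cons.IH by (simp add: mult.assoc)
  qed simp
  then show ?thesis by (simp add: word_value_def)
qed

lemma eval_superset: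
  assumes "finite A" "Poly_Mapping.keys x \<subseteq> A"
  shows "eval x = (\<Sum>w\<in>A. sc (Poly_Mapping.lookup x w) * word_value w)"
  unfolding eval_def
  by (rule sum.mono_neutral_left) (use assms in \<open>auto simp: in_keys_iff\<close>)

lemma eval_zero [simp]: "eval 0 = 0"
  by (simp add: eval_def)

lemma eval_add: "eval (x + y) = eval x + eval y"
proof -
  let ?A = "Poly_Mapping.keys x \<union> Poly_Mapping.keys y"
  have "Poly_Mapping.keys (x + y) \<subseteq> ?A" by (rule keys_add)
  then show ?thesis
    by (simp add: eval_superset[of ?A] lookup_add sc_add distrib_right sum.distrib)
qed

lemma eval_single: "eval (Poly_Mapping.single w a) = sc a * word_value w"
  by (simp add: eval_def)

lemma eval_gen [simp]: "eval (gen x) = g x"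
  by (simp add: gen_def eval_single word_value_def)

lemma eval_sum: "eval (sum f A) = (\<Sum>i\<in>A. eval (f i))"
  by (induction A rule: infinite_finite_induct) (auto simp: eval_add)

lemma eval_mult: "eval (x * y) = eval x * eval y"
proof -
  let ?s = "\<lambda>x w. Poly_Mapping.single w (Poly_Mapping.lookup x w)"
  have *: "eval (Poly_Mapping.single u a * Poly_Mapping.single v b)
      = eval (Poly_Mapping.single u a) * eval (Poly_Mapping.single v b)" for u v a b
  proof -
    have "sc a * (sc b * (word_value u * word_value v))
        = sc a * (word_value u * (sc b * word_value v))"
      by (metis sc_word_value mult.assoc)
    then show ?thesis
      by (simp add: mult_single eval_single sc_mult word_value_add mult.assoc)
  qed
  have "eval (sum (?s x) (Poly_Mapping.keys x) * sum (?s y) (Poly_Mapping.keys y))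
      = eval (sum (?s x) (Poly_Mapping.keys x)) * eval (sum (?s y) (Poly_Mapping.keys y))"
    by (simp add: sum_product eval_sum * del: sum_single_lookup)
  then show ?thesis by (simp only: sum_single_lookup)
qed

lemma eval_uminus: "eval (- x) = - eval x"
  using eval_add[of x "- x"] by (simp add: eq_neg_iff_add_eq_0 add.commute)

lemma eval_diff: "eval (x - y) = eval x - eval y"
  using eval_add[of x "- y"] by (simp add: eval_uminus)

lemma eval_alg_ideal:
  assumes "x \<in> alg_ideal X R" "\<And>y. y \<in> R \<Longrightarrow> eval y = 0"
  shows "eval x = 0"
  using assms(1) by induction (auto simp: assms(2) eval_add eval_mult)

end

section \<open>The regular representation of a quotient of the free algebra\<close>

interpretation free_alg: vector_space
  "\<lambda>c (x :: 'a free_word \<Rightarrow>\<^sub>0 'k::field). Poly_Mapping.single 0 c * x"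
  by unfold_locales
    (auto simp: algebra_simps single_add mult_single simp flip: mult.assoc)

text \<open>
  Serves to choose representatives modulo an ideal, and to discard words, in a linear way.
\<close>

lemma free_alg_retraction:
  fixes V :: "('a free_word \<Rightarrow>\<^sub>0 'k::field) set"
  assumes "free_alg.subspace V"
  obtains f where
    "\<And>x y. f (x + y) = f x + f y"
    "\<And>c x. f (Poly_Mapping.single 0 c * x) = Poly_Mapping.single 0 c * f x"
    "\<And>x. f x \<in> V" "\<And>x. x \<in> V \<Longrightarrow> f x = x"
proof -
  interpret vector_space_pair
    "\<lambda>c (x :: 'a free_word \<Rightarrow>\<^sub>0 'k). Poly_Mapping.single 0 c * x"
    "\<lambda>c (x :: 'a free_word \<Rightarrow>\<^sub>0 'k). Poly_Mapping.single 0 c * x"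
    by unfold_locales
  obtain f where f: "range f \<subseteq> V" "\<forall>v\<in>V. f v = v"
    and "Vector_Spaces.linear (\<lambda>c (x :: 'a free_word \<Rightarrow>\<^sub>0 'k). Poly_Mapping.single 0 c * x)
      (\<lambda>c (x :: 'a free_word \<Rightarrow>\<^sub>0 'k). Poly_Mapping.single 0 c * x) f"
    using linear_exists_left_inverse_on[OF free_alg.linear_id assms] by auto
  then interpret Vector_Spaces.linear "\<lambda>c (x :: 'a free_word \<Rightarrow>\<^sub>0 'k). Poly_Mapping.single 0 c * x"
    "\<lambda>c (x :: 'a free_word \<Rightarrow>\<^sub>0 'k). Poly_Mapping.single 0 c * x" f by simp
  show ?thesis using that[of f] f add scale by blast
qed

lemma single_zero_commute:
  fixes x :: "'a free_word \<Rightarrow>\<^sub>0 'k::field"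
  shows "x * (Poly_Mapping.single 0 c * y) = Poly_Mapping.single 0 c * (x * y)"
proof -
  let ?s = "\<lambda>w. Poly_Mapping.single w (Poly_Mapping.lookup x w)"
  have "?s w * Poly_Mapping.single 0 c = Poly_Mapping.single 0 c * ?s w" for w
    by (simp add: mult_single mult.commute)
  then have "sum ?s (Poly_Mapping.keys x) * Poly_Mapping.single 0 c
      = Poly_Mapping.single 0 c * sum ?s (Poly_Mapping.keys x)"
    by (simp only: sum_distrib_left sum_distrib_right)
  then have "x * Poly_Mapping.single 0 c = Poly_Mapping.single 0 c * x"
    by (simp only: sum_single_lookup)
  then show ?thesis by (simp flip: mult.assoc)
qed

text \<open>
  An algebra given by generators and relators embeds into a ring of endomorphisms. Let \<open>f\<close>
  be a linear projection of the free algebra onto the ideal \<open>I\<close>; then \<open>p = id - f\<close>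
  picks linearly a representative of each class modulo \<open>I\<close>. A generator \<open>l\<close> acts by
  \<open>y \<mapsto> p (l * h y)\<close>, where \<open>h\<close> is a linear projection onto the words over \<open>X\<close>.
  The projection \<open>h\<close> is there because \<open>I\<close> absorbs products with letters from \<open>X\<close>
  only. As \<open>p\<close> may be applied to intermediate products without changing the class, a word acts by
  \<open>y \<mapsto> p (w * h y)\<close>, and applying \<open>x\<close> to the empty word gives back \<open>p x\<close>, which is
  zero exactly on \<open>I\<close>.
\<close>

lemma quotient_embeds_in_endo:
  fixes R :: "('a free_word \<Rightarrow>\<^sub>0 'k::field) set"
  assumes R: "R \<subseteq> carrier (free_rng X)"
  obtains sc :: "'k \<Rightarrow> ('a free_word \<Rightarrow>\<^sub>0 'k) endo" and g
  where "generator_assignment sc g"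
    "\<And>x. x \<in> carrier (free_rng X) \<Longrightarrow>
       generator_assignment.eval sc g x = 0 \<longleftrightarrow> x \<in> alg_ideal X R"
proof -
  let ?I = "alg_ideal X R" and ?F = "carrier (free_rng X) :: ('a free_word \<Rightarrow>\<^sub>0 'k) set"
  let ?sc = "\<lambda>c. Poly_Mapping.single (0 :: 'a free_word) (c :: 'k)"
  let ?U = "{x :: 'a free_word \<Rightarrow>\<^sub>0 'k. \<forall>w\<in>Poly_Mapping.keys x. set (letters w) \<subseteq> X}"
  have I_sub: "?I \<subseteq> ?F" using R by (rule alg_ideal_subset)
  have "free_alg.subspace ?I"
    by (auto simp: free_alg.subspace_def intro: alg_ideal.intros)
  then obtain f where f: "\<And>x y. f (x + y) = f x + f y" "\<And>c x. f (?sc c * x) = ?sc c * f x"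
    "\<And>x. f x \<in> ?I" "\<And>x. x \<in> ?I \<Longrightarrow> f x = x"
    by (rule free_alg_retraction) blast
  have U_scale: "?sc c * x \<in> ?U" if "x \<in> ?U" for c x
    using that keys_mult[of "?sc c" x] by (fastforce split: if_splits)
  have "free_alg.subspace ?U"
    unfolding free_alg.subspace_def
  proof (intro conjI ballI allI)
    show "x + y \<in> ?U" if "x \<in> ?U" "y \<in> ?U" for x y
      using that keys_add[of x y] by blast
  qed (use U_scale in auto)
  then obtain h where h: "\<And>x y. h (x + y) = h x + h y" "\<And>c x. h (?sc c * x) = ?sc c * h x"
    "\<And>x. h x \<in> ?U" "\<And>x. x \<in> ?U \<Longrightarrow> h x = x"
    by (rule free_alg_retraction) blast
  have FU: "?F \<subseteq> ?U" by (auto simp: free_rng_def)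
  have F_mult: "x * y \<in> ?F" if "x \<in> ?F" "y \<in> ?U" for x y
    using that keys_mult[of x y] by (fastforce simp: free_rng_def plus_free_word_def)
  have I_mult: "x * y \<in> ?I" if "x \<in> ?I" "y \<in> ?U" for x y
  proof -
    \<comment> \<open>the ideal of the non-unital algebra absorbs scalars and non-empty words separately\<close>
    let ?c = "?sc (Poly_Mapping.lookup y 0)"
    have "w \<noteq> 0 \<and> set (letters w) \<subseteq> X" if "w \<in> Poly_Mapping.keys (y - ?c)" for w
      using that \<open>y \<in> ?U\<close>
      by (cases "w = 0") (auto simp: in_keys_iff lookup_minus lookup_single_not_eq)
    then have "y - ?c \<in> ?F"
      by (auto simp: free_rng_def zero_free_word_def) (metis free_word.collapse)+
    then have "?c * x + x * (y - ?c) \<in> ?I"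
      using that by (intro alg_ideal.add alg_ideal.scale alg_ideal.mult_right)
    moreover have "x * ?c = ?c * x"
      using single_zero_commute[of x _ 1] by simp
    ultimately show ?thesis by (simp add: algebra_simps)
  qed
  define p where "p x = x - f x" for x
  have p_add: "p (x + y) = p x + p y" and p_scale: "p (?sc c * x) = ?sc c * p x" for x y c
    by (simp_all add: p_def f algebra_simps)
  have p_I: "p x = 0" if "x \<in> ?I" for x using f(4)[OF that] by (simp add: p_def)
  have p_F: "p x \<in> ?F" if "x \<in> ?F" for x
    unfolding p_def using that f(3) I_sub by (blast intro: diff_mem_free_rng)
  have p_mult: "p (x * p y) = p (x * y)" if "x \<in> ?F" for x y
  proof -
    have "x * f y \<in> ?I" using f(3) that by (rule alg_ideal.mult_left)
    moreover have "p (x * y) = p (x * p y) + p (x * f y)"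
      by (simp add: p_add[symmetric]) (simp add: p_def algebra_simps)
    ultimately show ?thesis using p_I by simp
  qed
  define sc where "sc c = Endo (\<lambda>y. ?sc c * y)" for c
  define g where "g l = (if l \<in> X then Endo (\<lambda>y. p (gen l * h y)) else 0)" for l
  have app_sc: "app (sc c) y = ?sc c * y" for c y
    unfolding sc_def by (subst app_Endo) (auto simp: algebra_simps)
  have app_g: "app (g l) y = p (gen l * h y)" if "l \<in> X" for l y
    unfolding g_def if_P[OF that]
    by (subst app_Endo) (auto simp: algebra_simps h p_add)
  interpret G: generator_assignment sc g
  proof
    show "sc c * g l = g l * sc c" for c l
      by (rule endo_eqI, cases "l \<in> X")
        (auto simp: app_sc app_g h single_zero_commute p_scale, auto simp: g_def)
  qed (auto intro!: endo_eqI simp: app_sc single_add algebra_simps mult_single simp flip: mult.assoc)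
  have word: "app (G.word_value (FWord (l # ls))) y
      = p (Poly_Mapping.single (FWord (l # ls)) 1 * h y)" if "set (l # ls) \<subseteq> X" for l ls y
    using that
  proof (induction ls arbitrary: l)
    case Nil
    then show ?case by (simp add: G.word_value_def app_g gen_def)
  next
    case (Cons k ls)
    let ?w = "Poly_Mapping.single (FWord (k # ls)) (1 :: 'k)"
    have w: "?w \<in> ?F" using Cons.prems by (simp add: free_rng_def)
    then have "p (?w * h y) \<in> ?F" by (intro p_F F_mult h)
    then have "h (p (?w * h y)) = p (?w * h y)"
      using FU h(4) by blast
    moreover have "app (G.word_value (FWord (l # k # ls))) y
        = app (g l) (app (G.word_value (FWord (k # ls))) y)"
      by (simp add: G.word_value_def)
    moreover have "gen l * (?w * h y) = Poly_Mapping.single (FWord (l # k # ls)) 1 * h y"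
      by (simp add: gen_def mult_single plus_free_word_def flip: mult.assoc)
    ultimately show ?case
      using Cons by (simp add: app_g p_mult gen_mem_free_rng)
  qed
  have eval: "app (G.eval x) y = p (x * h y)" if "x \<in> ?F" for x y
  proof -
    let ?K = "Poly_Mapping.keys x"
    let ?s = "\<lambda>w. Poly_Mapping.single w (Poly_Mapping.lookup x w)"
    have p_sum: "p (sum u A) = (\<Sum>i\<in>A. p (u i))" for u and A :: "'a free_word set"
      by (induction A rule: infinite_finite_induct) (auto simp: p_add p_I alg_ideal.zero)
    have "app (sc c * G.word_value w) y = p (Poly_Mapping.single w c * h y)"
      if "w \<in> ?K" for w c
    proof -
      have "letters w \<noteq> []" "set (letters w) \<subseteq> X" using that \<open>x \<in> ?F\<close> by (auto simp: free_rng_def)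
      then obtain l ls where w: "w = FWord (l # ls)" "set (l # ls) \<subseteq> X"
        by (metis free_word.collapse neq_Nil_conv)
      have "?sc c * (Poly_Mapping.single w 1 * h y) = Poly_Mapping.single w c * h y"
        by (simp add: mult_single flip: mult.assoc)
      then show ?thesis using word[OF w(2)] by (simp add: app_sc w(1) flip: p_scale)
    qed
    then have "app (G.eval x) y = (\<Sum>w\<in>?K. p (?s w * h y))"
      by (simp add: G.eval_def app_sum del: app_simps)
    also have "\<dots> = p (sum ?s ?K * h y)"
      by (simp add: p_sum sum_distrib_right)
    finally show ?thesis by (simp only: sum_single_lookup)
  qed
  show ?thesis
  proof (rule that)
    show "generator_assignment sc g" by unfold_locales
    fix x assume x: "x \<in> ?F"
    show "G.eval x = 0 \<longleftrightarrow> x \<in> ?I"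
    proof
      assume "G.eval x = 0"
      then have "p (x * h 1) = 0" using eval[OF x, of 1] by simp
      moreover have "h 1 = 1" by (rule h) (simp add: zero_free_word_def)
      ultimately have "f x = x" by (simp add: p_def)
      then show "x \<in> ?I" using f(3) by metis
    next
      assume "x \<in> ?I"
      then show "G.eval x = 0" by (intro endo_eqI) (simp add: eval[OF x] p_I[OF I_mult[OF _ h(3)]])
    qed
  qed
qed

section \<open>Leavitt families\<close>

text \<open>
  Images of the vertices, edges and ghost edges that satisfy the defining relations. Formulating
  the reduction theorem for such families, instead of the quotient ring, allows it to be applied to
  the image of the regular representation; the boundary path representation below is a second
  instance.
\<close>

locale leavitt_family = wf_digraph E + generator_assignment sc g
  for E :: "('v, 'e) pre_digraph" and sc :: "'k::field \<Rightarrow> 'r::ring_1"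
    and g :: "('v, 'e) lpa_gen \<Rightarrow> 'r" +
  assumes relators_vanish: "x \<in> lpa_relators E \<Longrightarrow> eval x = 0"
begin

abbreviation P where "P v \<equiv> g (Vertex v)"
abbreviation S where "S e \<equiv> g (Edge e)"
abbreviation T where "T e \<equiv> g (Ghost e)"

definition alg :: "'r set" where
  "alg = eval ` carrier (free_rng (lpa_gens E))"

lemma alg_closed:
  "0 \<in> alg" "x \<in> alg \<Longrightarrow> y \<in> alg \<Longrightarrow> x + y \<in> alg"
  "x \<in> alg \<Longrightarrow> y \<in> alg \<Longrightarrow> x - y \<in> alg"
  "x \<in> alg \<Longrightarrow> y \<in> alg \<Longrightarrow> x * y \<in> alg" "x \<in> alg \<Longrightarrow> sc c * x \<in> alg"
proof -
  show "0 \<in> alg" unfolding alg_def using zero_mem_free_rng by (metis eval_zero imageI)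
  show "x + y \<in> alg" if "x \<in> alg" "y \<in> alg" for x y
    using that by (auto simp: alg_def simp flip: eval_add intro!: imageI plus_mem_free_rng)
  show "x - y \<in> alg" if "x \<in> alg" "y \<in> alg" for x y
    using that by (auto simp: alg_def simp flip: eval_diff intro!: imageI diff_mem_free_rng)
  show "x * y \<in> alg" if "x \<in> alg" "y \<in> alg" for x y
    using that by (auto simp: alg_def simp flip: eval_mult intro!: imageI mult_mem_free_rng)
  show "sc c * x \<in> alg" if x: "x \<in> alg" for x c
  proof -
    obtain y where y: "y \<in> carrier (free_rng (lpa_gens E))" "x = eval y"
      using x by (auto simp: alg_def)
    have "sc c * x = eval (Poly_Mapping.single 0 c * y)"
      by (simp add: y eval_mult eval_single)
    then show ?thesis using scale_mem_free_rng[OF y(1)] by (auto simp: alg_def)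
  qed
qed

lemma gen_in_alg: "l \<in> lpa_gens E \<Longrightarrow> g l \<in> alg"
  unfolding alg_def using gen_mem_free_rng by (metis eval_gen imageI)

lemma generators_in_alg [simp]:
  "v \<in> verts E \<Longrightarrow> P v \<in> alg" "e \<in> arcs E \<Longrightarrow> S e \<in> alg" "e \<in> arcs E \<Longrightarrow> T e \<in> alg"
  by (auto intro!: gen_in_alg simp: lpa_gens_def)

lemma P_mult: "v \<in> verts E \<Longrightarrow> w \<in> verts E \<Longrightarrow> P v * P w = (if v = w then P v else 0)"
  using relators_vanish[OF vertex_idem[of v E]] relators_vanish[OF vertex_orth[of v E w]]
  by (auto simp: eval_diff eval_mult)

lemma P_idem [simp]: "v \<in> verts E \<Longrightarrow> P v * P v = P v"
  by (simp add: P_mult)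

lemma P_S [simp]: "e \<in> arcs E \<Longrightarrow> P (tail E e) * S e = S e"
  using relators_vanish[OF source_edge[of e E]] by (simp add: eval_diff eval_mult)

lemma S_P [simp]: "e \<in> arcs E \<Longrightarrow> S e * P (head E e) = S e"
  using relators_vanish[OF edge_range[of e E]] by (simp add: eval_diff eval_mult)

lemma P_T [simp]: "e \<in> arcs E \<Longrightarrow> P (head E e) * T e = T e"
  using relators_vanish[OF range_ghost[of e E]] by (simp add: eval_diff eval_mult)

lemma T_P [simp]: "e \<in> arcs E \<Longrightarrow> T e * P (tail E e) = T e"
  using relators_vanish[OF ghost_source[of e E]] by (simp add: eval_diff eval_mult)

lemma T_S: "e \<in> arcs E \<Longrightarrow> f \<in> arcs E \<Longrightarrow> T e * S f = (if e = f then P (head E e) else 0)"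
  using relators_vanish[OF ghost_edge_same[of e E]]
    relators_vanish[OF ghost_edge_diff[of e E f]]
  by (auto simp: eval_diff eval_mult)

lemma cuntz_krieger_2: "regular_vertex E v \<Longrightarrow> (\<Sum>e\<in>out_arcs E v. S e * T e) = P v"
  using relators_vanish[OF lpa_relators.regular[of E v]]
  by (simp add: eval_diff eval_mult eval_sum)

lemma P_S': "e \<in> arcs E \<Longrightarrow> v \<in> verts E \<Longrightarrow> P v * S e = (if v = tail E e then S e else 0)"
  using mult.assoc[of "P v" "P (tail E e)" "S e"] by (auto simp: P_mult)

lemma T_P': "e \<in> arcs E \<Longrightarrow> v \<in> verts E \<Longrightarrow> T e * P v = (if v = tail E e then T e else 0)"
  using mult.assoc[of "T e" "P (tail E e)" "P v"] by (auto simp: P_mult)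

primrec path_elem :: "'v \<Rightarrow> 'e list \<Rightarrow> 'r" where
  "path_elem u [] = P u"
| "path_elem u (e # p) = S e * path_elem (head E e) p"

primrec ghost_elem :: "'v \<Rightarrow> 'e list \<Rightarrow> 'r" where
  "ghost_elem u [] = P u"
| "ghost_elem u (e # p) = ghost_elem (head E e) p * T e"

lemma awalk_verts: "awalk u p w \<Longrightarrow> u \<in> verts E" "awalk u p w \<Longrightarrow> w \<in> verts E"
  by auto

lemma path_elem_in_alg: "awalk u p w \<Longrightarrow> path_elem u p \<in> alg"
  by (induction p arbitrary: u) (auto simp: awalk_simps intro: alg_closed)

lemma ghost_elem_in_alg: "awalk u p w \<Longrightarrow> ghost_elem u p \<in> alg"
  by (induction p arbitrary: u) (auto simp: awalk_simps intro: alg_closed)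

lemma P_path_elem: "awalk u p w \<Longrightarrow> P u * path_elem u p = path_elem u p"
  by (cases p) (auto simp: awalk_simps simp flip: mult.assoc)

lemma path_elem_P: "awalk u p w \<Longrightarrow> path_elem u p * P w = path_elem u p"
  by (induction p arbitrary: u) (auto simp: awalk_simps mult.assoc)

lemma ghost_elem_P: "awalk u p w \<Longrightarrow> ghost_elem u p * P u = ghost_elem u p"
  by (cases p) (auto simp: awalk_simps mult.assoc)

lemma path_elem_append:
  "awalk u p w \<Longrightarrow> awalk w q w' \<Longrightarrow> path_elem u (p @ q) = path_elem u p * path_elem w q"
  by (induction p arbitrary: u) (auto simp: awalk_simps mult.assoc P_path_elem)

lemma path_elem_P':
  "awalk u p w \<Longrightarrow> v \<in> verts E \<Longrightarrow> path_elem u p * P v = (if v = w then path_elem u p else 0)"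
  using mult.assoc[of "path_elem u p" "P w" "P v"] awalk_verts[of u p w]
  by (auto simp: P_mult path_elem_P)

text \<open>
  The relations \<open>T_S\<close> cancel edges from the middle. Under the assumption on the lengths the
  ghost path is used up completely, so that no case with a ghost path as its value arises.
\<close>

lemma ghost_path:
  assumes "awalk u p w" "awalk u' q w'" "length p \<le> length q"
  shows "ghost_elem u p * path_elem u' q
    = (if u = u' \<and> prefix p q then path_elem w (drop (length p) q) else 0)"
  using assms
proof (induction p arbitrary: u u' q)
  case Nil
  then have "u = w" "u \<in> verts E" "u' \<in> verts E" by (auto simp: awalk_simps)
  moreover have "P u * path_elem u' q = P u * P u' * path_elem u' q"
    using P_path_elem[OF Nil(2)] by (simp add: mult.assoc)
  ultimately show ?case using P_path_elem[OF Nil(2)] by (auto simp: P_mult)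
next
  case (Cons e p)
  then obtain f q' where q: "q = f # q'" by (cases q) auto
  have e: "e \<in> arcs E" "tail E e = u" "awalk (head E e) p w"
    and f: "f \<in> arcs E" "tail E f = u'" "awalk (head E f) q' w'"
    using Cons.prems by (auto simp: q awalk_simps)
  have "ghost_elem u (e # p) * path_elem u' q
      = ghost_elem (head E e) p * (T e * S f) * path_elem (head E f) q'"
    by (simp add: q mult.assoc)
  also have "\<dots> = (if e = f then ghost_elem (head E e) p * path_elem (head E e) q' else 0)"
    using e f ghost_elem_P[OF e(3)] by (auto simp: T_S)
  also have "\<dots> = (if e = f \<and> prefix p q' then path_elem w (drop (length p) q') else 0)"
    using Cons.IH[OF e(3), of "head E e" q'] f Cons.prems(3) by (auto simp: q)
  finally show ?case using e f by (auto simp: q)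
qed

section \<open>The filtration by ghost degree\<close>

text \<open>
  The span of the elements \<open>\<mu> \<nu>\<^sup>*\<close> with paths \<open>\<mu>, \<nu>\<close> and \<open>\<nu>\<close> of length at most
  \<open>n\<close>. Building \<open>\<nu>\<^sup>*\<close> by right multiplications suits the use of the filtration:
  stability under right multiplication by the generators is all that is needed to see that it
  exhausts the algebra, and multiplying by an edge on the right takes the outermost ghost edge off.
\<close>

inductive ghost_le :: "nat \<Rightarrow> 'r \<Rightarrow> bool" where
  zero: "ghost_le n 0"
| add: "ghost_le n x \<Longrightarrow> ghost_le n y \<Longrightarrow> ghost_le n (x + y)"
| path: "awalk u p w \<Longrightarrow> ghost_le n (sc c * path_elem u p)"
| ghost: "ghost_le n x \<Longrightarrow> e \<in> arcs E \<Longrightarrow> ghost_le (Suc n) (x * T e)"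

lemma ghost_le_Suc: "ghost_le n x \<Longrightarrow> ghost_le (Suc n) x"
  by (induction rule: ghost_le.induct) (auto intro: ghost_le.intros)

lemma ghost_le_mono: "ghost_le m x \<Longrightarrow> m \<le> n \<Longrightarrow> ghost_le n x"
  by (induction n) (auto simp: le_Suc_eq intro: ghost_le_Suc)

lemma ghost_le_sum: "(\<And>i. i \<in> A \<Longrightarrow> ghost_le n (f i)) \<Longrightarrow> ghost_le n (sum f A)"
  by (induction A rule: infinite_finite_induct) (auto intro: ghost_le.intros)

lemma ghost_le_scale: "ghost_le n x \<Longrightarrow> ghost_le n (sc c * x)"
proof (induction rule: ghost_le.induct)
  case (path u p w n d)
  then show ?case using ghost_le.path[of u p w n "c * d"] by (simp add: sc_mult mult.assoc)
qed (auto simp: distrib_left simp flip: mult.assoc intro: ghost_le.zero ghost_le.add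
    ghost_le.ghost)

lemma ghost_le_P: "ghost_le n x \<Longrightarrow> v \<in> verts E \<Longrightarrow> ghost_le n (x * P v)"
proof (induction rule: ghost_le.induct)
  case (path u p w n d)
  then show ?case by (auto simp: mult.assoc path_elem_P' intro: ghost_le.intros)
qed (auto simp: distrib_right mult.assoc T_P' intro: ghost_le.intros)

lemma path_elem_S:
  assumes "awalk u p w" "e \<in> arcs E"
  shows "path_elem u p * S e = (if w = tail E e then path_elem u (p @ [e]) else 0)"
proof -
  have "path_elem u p * S e = path_elem u p * P w * S e"
    using assms by (simp add: path_elem_P)
  also have "\<dots> = (if w = tail E e then path_elem u p * S e else 0)"
    using assms awalk_verts by (auto simp: mult.assoc P_S')
  also have "\<dots> = (if w = tail E e then path_elem u (p @ [e]) else 0)"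
    using assms path_elem_append[OF assms(1), of "[e]" "head E e"]
    by (auto simp: awalk_simps)
  finally show ?thesis .
qed

lemma ghost_le_S: "ghost_le n x \<Longrightarrow> e \<in> arcs E \<Longrightarrow> ghost_le n (x * S e)"
proof (induction rule: ghost_le.induct)
  case (path u p w n d)
  have "awalk u (p @ [e]) (head E e)" if "w = tail E e"
    using path that awalk_verts[OF path(1)]
    by (intro awalk_appendI[OF path(1)]) (auto simp: awalk_simps)
  then show ?case
    using path by (auto simp: mult.assoc path_elem_S intro: ghost_le.intros)
next
  case (ghost n x f)
  then show ?case
    by (auto simp: mult.assoc T_S intro: ghost_le_P ghost_le_Suc ghost_le.zero)
qed (auto simp: distrib_right intro: ghost_le.intros)

text \<open>
  A non-empty word is a generator followed by right multiplications by generators, and each of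
  these stays within the filtration.
\<close>

lemma alg_ghost_le:
  assumes "x \<in> alg"
  obtains n where "ghost_le n x"
proof -
  have start: "\<exists>n. ghost_le n (g l)" if l: "l \<in> lpa_gens E" for l
  proof -
    have P: "ghost_le 0 (P v)" if "v \<in> verts E" for v
      using ghost_le.path[of v "[]" v 0 1] that by (simp add: awalk_simps)
    consider v where "v \<in> verts E" "l = Vertex v" | e where "e \<in> arcs E" "l = Edge e"
      | e where "e \<in> arcs E" "l = Ghost e"
      using l by (auto simp: lpa_gens_def)
    then show ?thesis
    proof cases
      case 2
      then show ?thesis
        using ghost_le_S[OF P[of "tail E e"], of e] by auto
    next
      case 3
      then show ?thesis
        using ghost_le.ghost[OF P[of "head E e"], of e] by auto
    qed (use P in auto)
  qed
  have step: "\<exists>n. ghost_le n (y * g l)" if l: "l \<in> lpa_gens E" and y: "ghost_le m y" for l y m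
    using l ghost_le_P[OF y] ghost_le_S[OF y] ghost_le.ghost[OF y] by (auto simp: lpa_gens_def)
  have words: "\<exists>n. ghost_le n (prod_list (map g ls))"
    if "ls \<noteq> []" "set ls \<subseteq> lpa_gens E" for ls
    using that
  proof (induction ls rule: rev_nonempty_induct)
    case (single l)
    then show ?case using start by simp
  next
    case (snoc l ls)
    then show ?case using step by auto
  qed
  obtain y where y: "y \<in> carrier (free_rng (lpa_gens E))" "x = eval y"
    using assms by (auto simp: alg_def)
  have "\<forall>w\<in>Poly_Mapping.keys y. \<exists>n. ghost_le n (word_value w)"
    using y words by (auto simp: free_rng_def word_value_def)
  then obtain N where N: "\<And>w. w \<in> Poly_Mapping.keys y \<Longrightarrow> ghost_le (N w) (word_value w)"
    by metis
  have "ghost_le (Max (N ` Poly_Mapping.keys y)) (word_value w)"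
    if "w \<in> Poly_Mapping.keys y" for w
    using ghost_le_mono[OF N[OF that]] that by simp
  then have "ghost_le (Max (N ` Poly_Mapping.keys y)) x"
    unfolding y eval_def by (intro ghost_le_sum ghost_le_scale)
  then show thesis by (rule that)
qed

text \<open>
  Sums of vertices are local units. The quantification over all larger sets \<open>W\<close>
  makes the statement stable under sums.
\<close>

lemma ghost_le_right_unit:
  "ghost_le n x \<Longrightarrow> \<exists>V. finite V \<and> V \<subseteq> verts E \<and> (\<forall>W. finite W \<longrightarrow> W \<subseteq> verts E \<longrightarrow> V \<subseteq> W \<longrightarrow> x * (\<Sum>v\<in>W. P v) = x)"
proof (induction rule: ghost_le.induct)
  case (zero n)
  then show ?case by auto
next
  case (add n x y)
  then obtain V V' where "finite V" "V \<subseteq> verts E" "\<And>W. finite W \<Longrightarrow> W \<subseteq> verts E \<Longrightarrow> V \<subseteq> W \<Longrightarrow> x * (\<Sum>v\<in>W. P v) = x"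
     "finite V'" "V' \<subseteq> verts E" "\<And>W. finite W \<Longrightarrow> W \<subseteq> verts E \<Longrightarrow> V' \<subseteq> W \<Longrightarrow> y * (\<Sum>v\<in>W. P v) = y"
    by blast
  then show ?case
    by (intro exI[of _ "V \<union> V'"]) (auto simp: distrib_right)
next
  case (path u p w n c)
  then have "path_elem u p * (\<Sum>v\<in>W. P v) = path_elem u p"
    if "finite W" "W \<subseteq> verts E" "w \<in> W" for W
    using that by (simp add: sum_distrib_left subset_iff path_elem_P' sum.delta cong: sum.cong)
  then show ?case using awalk_verts[OF path]
    by (intro exI[of _ "{w}"]) (auto simp: mult.assoc)
next
  case (ghost n x e)
  then have "T e * (\<Sum>v\<in>W. P v) = T e"
    if "finite W" "W \<subseteq> verts E" "tail E e \<in> W" for W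
    using that by (simp add: sum_distrib_left subset_iff T_P' sum.delta cong: sum.cong)
  then show ?case using ghost
    by (intro exI[of _ "{tail E e}"]) (auto simp: mult.assoc)
qed

lemma ghost_le_vertex_nonzero:
  assumes "ghost_le n x" "x \<noteq> 0"
  obtains w where "w \<in> verts E" "x * P w \<noteq> 0"
proof -
  obtain V where V: "finite V" "V \<subseteq> verts E" "x * (\<Sum>v\<in>V. P v) = x"
    using ghost_le_right_unit[OF assms(1)] by blast
  then have "(\<Sum>v\<in>V. x * P v) \<noteq> 0" using assms(2) by (simp add: sum_distrib_left)
  then obtain w where "w \<in> V" "x * P w \<noteq> 0" by (meson sum.neutral)
  then show thesis using that V by blast
qed

text \<open>
  This gives control over right multiplication by an edge \<open>e\<close>: it removes the last ghost edge from
  \<open>b e * T e\<close> and kills the other terms of the sum.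
\<close>

lemma ghost_le_decompose:
  assumes "ghost_le (Suc n) x"
  shows "\<exists>a b F. ghost_le 0 a \<and> finite F \<and> F \<subseteq> arcs E \<and> (\<forall>e. ghost_le n (b e)) \<and>
     (\<forall>e. e \<notin> F \<longrightarrow> b e = 0) \<and> x = a + (\<Sum>e\<in>F. b e * T e)"
  using assms
proof (induction "Suc n" x rule: ghost_le.induct)
  case zero
  show ?case
    by (rule exI[of _ 0], rule exI[of _ "\<lambda>_. 0"], rule exI[of _ "{}"])
      (auto intro: ghost_le.zero)
next
  case (add x y)
  obtain a b F where 1: "ghost_le 0 a" "finite F" "F \<subseteq> arcs E" "\<And>e. ghost_le n (b e)"
     "\<And>e. e \<notin> F \<Longrightarrow> b e = 0" "x = a + (\<Sum>e\<in>F. b e * T e)"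
    using add by blast
  obtain a' b' F' where 2: "ghost_le 0 a'" "finite F'" "F' \<subseteq> arcs E" "\<And>e. ghost_le n (b' e)"
     "\<And>e. e \<notin> F' \<Longrightarrow> b' e = 0" "y = a' + (\<Sum>e\<in>F'. b' e * T e)"
    using add by blast
  have "(\<Sum>e\<in>F. b e * T e) = (\<Sum>e\<in>F \<union> F'. b e * T e)"
    "(\<Sum>e\<in>F'. b' e * T e) = (\<Sum>e\<in>F \<union> F'. b' e * T e)"
    using 1 2 by (auto intro!: sum.mono_neutral_left)
  then have "x + y = (a + a') + (\<Sum>e\<in>F \<union> F'. (b e + b' e) * T e)"
    using 1(6) 2(6) by (simp add: distrib_right sum.distrib)
  then show ?case
    using 1 2 by (intro exI[of _ "a + a'"] exI[of _ "\<lambda>e. b e + b' e"] exI[of _ "F \<union> F'"])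
      (auto intro: ghost_le.add)
next
  case (path u p w c)
  then show ?case
    by (intro exI[of _ "sc c * path_elem u p"] exI[of _ "\<lambda>_. 0"] exI[of _ "{}"])
      (auto intro: ghost_le.zero ghost_le.path)
next
  case (ghost x e)
  then show ?case
    by (intro exI[of _ 0] exI[of _ "\<lambda>f. if f = e then x else 0"] exI[of _ "{e}"])
      (auto intro: ghost_le.zero)
qed

text \<open>
  The combination is required to be non-zero formally, as a family of coefficients of distinct paths,
  and not by its value: right multiplication by an edge clearly preserves the former, whereas the
  latter would call for the linear independence of paths.
\<close>

definition path_combination :: "'v \<Rightarrow> 'r \<Rightarrow> bool" where
  "path_combination w x \<longleftrightarrow> (\<exists>A k. finite A \<and> A \<noteq> {} \<and>
     (\<forall>(u, p)\<in>A. awalk u p w \<and> k (u, p) \<noteq> 0) \<and>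
     x = (\<Sum>(u, p)\<in>A. sc (k (u, p)) * path_elem u p))"

lemma ghost_le_0_path_sum:
  assumes "ghost_le 0 x"
  shows "\<exists>A k. finite A \<and> (\<forall>(u, p)\<in>A. \<exists>w. awalk u p w) \<and> (\<forall>q. q \<notin> A \<longrightarrow> k q = 0) \<and>
     x = (\<Sum>(u, p)\<in>A. sc (k (u, p)) * path_elem u p)"
  using assms
proof (induction "0::nat" x rule: ghost_le.induct)
  case zero
  show ?case by (rule exI[of _ "{}"], rule exI[of _ "\<lambda>_. 0"]) auto
next
  case (add x y)
  obtain A k where 1: "finite A" "\<forall>(u, p)\<in>A. \<exists>w. awalk u p w" "\<And>q. q \<notin> A \<Longrightarrow> k q = 0"
    "x = (\<Sum>(u, p)\<in>A. sc (k (u, p)) * path_elem u p)" using add by blast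
  obtain A' k' where 2: "finite A'" "\<forall>(u, p)\<in>A'. \<exists>w. awalk u p w" "\<And>q. q \<notin> A' \<Longrightarrow> k' q = 0"
    "y = (\<Sum>(u, p)\<in>A'. sc (k' (u, p)) * path_elem u p)" using add by blast
  have "x = (\<Sum>(u, p)\<in>A \<union> A'. sc (k (u, p)) * path_elem u p)"
    "y = (\<Sum>(u, p)\<in>A \<union> A'. sc (k' (u, p)) * path_elem u p)"
    unfolding 1(4) 2(4) using 1 2 by (auto intro!: sum.mono_neutral_left)
  then have "x + y = (\<Sum>(u, p)\<in>A \<union> A'. sc (k (u, p) + k' (u, p)) * path_elem u p)"
    by (simp add: sum.distrib[symmetric] sc_add distrib_right case_prod_unfold)
  then show ?case
    using 1 2 by (intro exI[of _ "A \<union> A'"] exI[of _ "\<lambda>q. k q + k' q"]) auto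
next
  case (path u p w c)
  then show ?case
    by (intro exI[of _ "{(u, p)}"] exI[of _ "\<lambda>q. if q = (u, p) then c else 0"]) auto
qed

lemma path_combination_corner:
  assumes "ghost_le 0 x" "w \<in> verts E" "x * P w \<noteq> 0"
  shows "path_combination w (x * P w)"
proof -
  obtain A k where A: "finite A" "\<forall>(u, p)\<in>A. \<exists>w. awalk u p w"
    "x = (\<Sum>(u, p)\<in>A. sc (k (u, p)) * path_elem u p)"
    using ghost_le_0_path_sum[OF assms(1)] by blast
  define B where "B = {(u, p) \<in> A. awalk u p w \<and> k (u, p) \<noteq> 0}"
  have "x * P w = (\<Sum>(u, p)\<in>A. sc (k (u, p)) * (path_elem u p * P w))"
    unfolding A(3) sum_distrib_right by (simp add: case_prod_unfold mult.assoc)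
  also have "\<dots> = (\<Sum>(u, p)\<in>B. sc (k (u, p)) * (path_elem u p * P w))"
  proof (intro sum.mono_neutral_right ballI)
    fix q assume q: "q \<in> A - B"
    obtain u p where [simp]: "q = (u, p)" by (cases q)
    obtain w' where w': "awalk u p w'" using A(2) q by auto
    then have "path_elem u p * P w = 0 \<or> k q = 0"
      using path_elem_P'[OF w' assms(2)] q by (auto simp: B_def)
    then show "(case q of (u, p) \<Rightarrow> sc (k (u, p)) * (path_elem u p * P w)) = 0" by auto
  qed (use A in \<open>auto simp: B_def\<close>)
  also have "\<dots> = (\<Sum>(u, p)\<in>B. sc (k (u, p)) * path_elem u p)"
    by (rule sum.cong) (auto simp: B_def path_elem_P)
  finally have *: "x * P w = (\<Sum>(u, p)\<in>B. sc (k (u, p)) * path_elem u p)" .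
  moreover have "B \<noteq> {}" using assms(3) unfolding * by auto
  moreover have "finite B" using A(1) by (auto simp: B_def intro: finite_subset)
  ultimately show ?thesis unfolding path_combination_def
    by (intro exI[of _ B] exI[of _ k]) (auto simp: B_def)
qed

lemma path_combination_extend:
  assumes "path_combination w x" "e \<in> arcs E" "tail E e = w"
  shows "path_combination (head E e) (x * S e)"
proof -
  obtain A k where A: "finite A" "A \<noteq> {}" "\<forall>(u, p)\<in>A. awalk u p w \<and> k (u, p) \<noteq> 0"
    "x = (\<Sum>(u, p)\<in>A. sc (k (u, p)) * path_elem u p)"
    using assms(1) unfolding path_combination_def by blast
  let ?h = "\<lambda>(u, p). (u, p @ [e])"
  have inj: "inj_on ?h A" by (auto simp: inj_on_def)
  have "x * S e = (\<Sum>(u, p)\<in>A. sc (k (u, p)) * path_elem u (p @ [e]))"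
    unfolding A(4) sum_distrib_right
  proof (rule sum.cong)
    fix q assume "q \<in> A"
    then show "(case q of (u, p) \<Rightarrow> sc (k (u, p)) * path_elem u p) * S e
        = (case q of (u, p) \<Rightarrow> sc (k (u, p)) * path_elem u (p @ [e]))"
      using A(3) assms path_elem_S by (cases q) (auto simp: mult.assoc)
  qed simp
  also have "\<dots> = (\<Sum>(u, p)\<in>?h ` A. sc (k (u, butlast p)) * path_elem u p)"
    by (subst sum.reindex[OF inj]) (auto intro!: sum.cong)
  finally have "x * S e = \<dots>" .
  moreover have "awalk u (p @ [e]) (head E e)" if "(u, p) \<in> A" for u p
    using A(3) that assms(2,3)
    by (intro awalk_appendI[of u p w]) (auto simp: awalk_simps)
  ultimately show ?thesis unfolding path_combination_def
    by (intro exI[of _ "?h ` A"] exI[of _ "\<lambda>(u, p). k (u, butlast p)"])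
      (use A in \<open>auto\<close>)
qed

text \<open>
  Induction on the ghost degree. Write \<open>x = a + (\<Sum>e\<in>F. b e * e\<^sup>*)\<close> with \<open>a\<close>
  free of ghosts, and choose a vertex \<open>w\<close> with \<open>x w \<noteq> 0\<close>. If \<open>x e \<noteq> 0\<close> for some
  \<open>e \<in> F\<close> that starts at \<open>w\<close>, then \<open>x e\<close> has smaller ghost degree. Otherwise
  \<open>x w = a Q\<close> for \<open>Q = w - (\<Sum>e. e e\<^sup>*)\<close>, the sum being over the edges in \<open>F\<close> from
  \<open>w\<close>, and so \<open>a w\<close> is a non-zero combination of paths. If \<open>w\<close> is a sink then
  \<open>x w = a w\<close>. If it is not, \<open>cuntz_krieger_2\<close> and \<open>Q \<noteq> 0\<close> provide an edge \<open>e\<close> from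
  \<open>w\<close> outside \<open>F\<close>, for which \<open>x e = a e\<close>.
\<close>

lemma reduce_to_path_combination:
  assumes "ghost_le n x" "x \<noteq> 0"
  shows "\<exists>y\<in>alg. \<exists>w. path_combination w (x * y)"
  using assms
proof (induction n arbitrary: x)
  case 0
  then obtain w where "w \<in> verts E" "x * P w \<noteq> 0" by (rule ghost_le_vertex_nonzero)
  then show ?case using path_combination_corner[OF 0(1)] by (intro bexI[of _ "P w"]) auto
next
  case (Suc n)
  obtain w where w: "w \<in> verts E" "x * P w \<noteq> 0"
    using Suc.prems by (rule ghost_le_vertex_nonzero)
  obtain a b F where F: "ghost_le 0 a" "finite F" "F \<subseteq> arcs E" "\<And>e. ghost_le n (b e)"
     "\<And>e. e \<notin> F \<Longrightarrow> b e = 0" "x = a + (\<Sum>e\<in>F. b e * T e)"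
    using ghost_le_decompose[OF Suc.prems(1)] by blast
  have xS: "x * S e = a * S e + b e * P (head E e)" if "e \<in> arcs E" for e
  proof -
    have "(\<Sum>f\<in>F. b f * T f) * S e = (\<Sum>f\<in>F. if f = e then b e * P (head E e) else 0)"
      unfolding sum_distrib_right
      by (rule sum.cong) (use F(3) that in \<open>auto simp: mult.assoc T_S\<close>)
    also have "\<dots> = b e * P (head E e)" using F(2,5) by (auto simp: sum.delta)
    finally show ?thesis by (simp add: F(6) distrib_right)
  qed
  let ?Fw = "{e \<in> F. tail E e = w}"
  show ?case
  proof (cases "\<exists>e\<in>?Fw. x * S e \<noteq> 0")
    case True
    then obtain e where e: "e \<in> F" "x * S e \<noteq> 0" by blast
    then have earc: "e \<in> arcs E" using F(3) by blast
    have "ghost_le n (x * S e)"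
      unfolding xS[OF earc]
      using F(1) F(4)[of e] earc by (intro ghost_le.add ghost_le_P ghost_le_S)
        (auto intro: ghost_le_mono)
    then obtain y v where "y \<in> alg" "path_combination v (x * S e * y)"
      using Suc.IH e by blast
    then show ?thesis
      using earc by (intro bexI[of _ "S e * y"]) (auto simp: mult.assoc intro: alg_closed)
  next
    case False
    let ?Q = "P w - (\<Sum>e\<in>?Fw. S e * T e)"
    have fin: "finite ?Fw" using F(2) by simp
    have "x * (\<Sum>e\<in>?Fw. S e * T e) = (\<Sum>e\<in>?Fw. x * S e * T e)"
      by (simp add: sum_distrib_left mult.assoc)
    also have "\<dots> = 0" using False by (intro sum.neutral) auto
    finally have xQ: "x * ?Q = x * P w" by (simp add: right_diff_distrib)
    \<comment> \<open>\<open>Q\<close> annihilates the ghost edges that occur in \<open>x\<close>, leaving only the ghost-free part\<close>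
    have TQ: "T f * ?Q = 0" if "f \<in> F" for f
    proof -
      have "(\<Sum>e\<in>?Fw. T f * (S e * T e)) = (\<Sum>e\<in>?Fw. if e = f then T f else 0)"
        by (rule sum.cong)
          (use F(3) that in \<open>auto simp: T_S subset_iff simp flip: mult.assoc\<close>)
      also have "\<dots> = (if tail E f = w then T f else 0)"
        using fin that by (auto simp: sum.delta)
      finally show ?thesis
        using w(1) that F(3) by (auto simp: right_diff_distrib sum_distrib_left T_P')
    qed
    have bQ: "(\<Sum>e\<in>F. b e * T e) * ?Q = 0"
      unfolding sum_distrib_right by (rule sum.neutral) (simp add: mult.assoc TQ)
    then have aQ: "a * ?Q \<noteq> 0"
      using w(2) xQ by (simp add: F(6) distrib_right)
    have "P w * ?Q = ?Q"
    proof -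
      have "(\<Sum>e\<in>?Fw. P w * (S e * T e)) = (\<Sum>e\<in>?Fw. S e * T e)"
        by (rule sum.cong) (use F(3) in \<open>auto simp flip: mult.assoc\<close>)
      then show ?thesis using w(1) by (simp add: right_diff_distrib sum_distrib_left)
    qed
    then have "a * P w * ?Q = a * ?Q" by (simp add: mult.assoc)
    then have aP: "a * P w \<noteq> 0" using aQ by auto
    have rp: "path_combination w (a * P w)" by (rule path_combination_corner[OF F(1) w(1) aP])
    show ?thesis
    proof (cases "out_arcs E w \<subseteq> ?Fw")
      case True
      then have eq: "out_arcs E w = ?Fw" using F(3) by (auto simp: out_arcs_def)
      show ?thesis
      proof (cases "out_arcs E w = {}")
        case True
        then have "?Fw = {}" using eq by simp
        then have "?Q = P w" by (simp only: sum.empty diff_zero)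
        then have "x * P w = a * P w" using bQ by (simp add: F(6) distrib_right)
        then show ?thesis using rp w(1) by (intro bexI[of _ "P w"]) auto
      next
        case False
        then have "regular_vertex E w" using w(1) fin eq by (simp add: regular_vertex_def)
        then have "?Q = 0" using cuntz_krieger_2[of w] unfolding eq by simp
        then show ?thesis using aQ by simp
      qed
    next
      case False
      then obtain e where e: "e \<in> arcs E" "tail E e = w" "e \<notin> F" by (auto simp: out_arcs_def)
      have "a * P w * S e = x * S e"
        using e F(5) P_S[OF e(1)] by (simp add: xS mult.assoc)
      then have "path_combination (head E e) (x * S e)" using path_combination_extend[OF rp e(1,2)] by simp
      then show ?thesis using e(1) by (intro bexI[of _ "S e"]) auto
    qed
  qed
qed

end

section \<open>Escaping from closed walks\<close>

lemma nth_concat_replicate: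
  "i < n * length c \<Longrightarrow> concat (replicate n c) ! i = c ! (i mod length c)"
proof (induction n arbitrary: i)
  case (Suc n)
  show ?case
  proof (cases "i < length c")
    case False
    then have "i mod length c = (i - length c) mod length c" by (simp add: le_mod_geq)
    then show ?thesis using Suc False by (simp add: nth_append)
  qed (simp add: nth_append)
qed simp

lemma length_concat_replicate: "length (concat (replicate n c)) = n * length c"
  by (induction n) auto

context wf_digraph
begin

lemma awalk_concat_replicate: "awalk w c w \<Longrightarrow> awalk w (concat (replicate n c)) w"
  by (induction n) (auto simp del: awalk_append_iff simp: awalk_Nil_iff intro: awalk_appendI)

lemma awalk_take:
  "awalk u p v \<Longrightarrow> i < length p \<Longrightarrow> awalk u (take i p) (tail G (p ! i))"
proof (induction p arbitrary: u i)
  case (Cons e p)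
  then show ?case by (cases i) (auto simp: awalk_simps)
qed simp

text \<open>
  Let \<open>c\<close> be a shortest non-empty closed walk at \<open>w\<close>. By minimality it returns to
  \<open>w\<close> only at its end, so Condition (L) provides an exit \<open>f\<close> at some position \<open>j\<close> of
  \<open>c\<close>. The walk \<open>q\<close> goes round \<open>c\<close> more often than any \<open>t\<close> in \<open>B\<close> is long, follows
  \<open>c\<close> up to position \<open>j\<close>, and leaves through \<open>f\<close>. If \<open>q\<close> were a prefix of
  \<open>t q\<close>, it would have period \<open>length t\<close>, at least as far as it is long; reading it at
  position \<open>length t\<close> shows that the length of \<open>c\<close> divides that of \<open>t\<close>, and so the last
  edge \<open>f\<close> of \<open>q\<close> would equal the edge of \<open>c\<close> at position \<open>j\<close>.
\<close>

lemma escaping_walk: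
  assumes L: "condition_L G" and w: "w \<in> verts G"
    and B: "finite B" "[] \<notin> B" "\<And>t. t \<in> B \<Longrightarrow> awalk w t w"
  obtains q w' where "awalk w q w'" "\<And>t. t \<in> B \<Longrightarrow> \<not> prefix q (t @ q)"
proof (cases "B = {}")
  case True
  then show thesis using that[of "[]" w] w by (simp add: awalk_simps)
next
  case False
  then obtain t0 where "t0 \<noteq> [] \<and> awalk w t0 w" using B by (metis ex_in_conv)
  then obtain c where c: "c \<noteq> []" "awalk w c w"
      and least: "\<And>t. t \<noteq> [] \<Longrightarrow> awalk w t w \<Longrightarrow> length c \<le> length t"
    using ex_has_least_nat[of "\<lambda>t. t \<noteq> [] \<and> awalk w t w" t0 length] by blast
  define m where "m = length c"
  have m: "m > 0" using c by (simp add: m_def)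
  have first: "i = 0" if "i < m" "tail G (c ! i) = w" for i
  proof (rule ccontr)
    assume "i \<noteq> 0"
    moreover have "awalk w (take i c) w" using awalk_take[OF c(2), of i] that by (simp add: m_def)
    ultimately have "length c \<le> length (take i c)" using c by (intro least) auto
    then show False using that by (simp add: m_def)
  qed
  have tail_hd: "tail G (c ! 0) = w" using c by (cases c) (auto simp: awalk_simps)
  have "simple_closed_path G c"
    unfolding simple_closed_path_def
  proof (intro conjI ballI exI)
    fix e assume "e \<in> set (tl c)"
    then obtain i where "i < length (tl c)" "e = tl c ! i" by (auto simp: in_set_conv_nth)
    then have "Suc i < m" "e = c ! Suc i" by (auto simp: m_def nth_tl)
    then show "tail G e \<noteq> tail G (hd c)" using first tail_hd c by (auto simp: hd_conv_nth)
  qed (use c in auto)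
  then obtain f e' where f: "f \<in> arcs G" "e' \<in> set c" "tail G f = tail G e'" "f \<noteq> e'"
    using L unfolding condition_L_def is_exit_def by blast
  then obtain j where j: "j < m" "tail G f = tail G (c ! j)" "f \<noteq> c ! j"
    by (auto simp: in_set_conv_nth m_def)
  define n where "n = Suc (Max (length ` B))"
  define q where "q = concat (replicate n c) @ take j c @ [f]"
  define N where "N = n * m + j"
  have len_q: "length q = Suc N"
    using j by (simp add: q_def length_concat_replicate N_def m_def)
  have q_N: "q ! N = f"
    using j by (simp add: q_def nth_append length_concat_replicate N_def m_def)
  have q_i: "q ! i = c ! (i mod m)" if "i < N" for i
  proof (cases "i < n * m")
    case True
    then show ?thesis by (simp add: q_def nth_append length_concat_replicate nth_concat_replicate m_def)
  next
    case False
    then have i: "i = n * m + (i - n * m)" "i - n * m < j" using that by (auto simp: N_def)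
    then have "i mod m = i - n * m" using j by (metis mod_less mod_mult_self3 order_less_trans)
    then show ?thesis using i False
      by (simp add: q_def nth_append length_concat_replicate m_def)
        (use j m_def in auto)
  qed
  have walk: "awalk w q (head G f)"
    unfolding q_def
    using awalk_concat_replicate[OF c(2)] awalk_take[OF c(2), of j] j f(1)
    by (intro awalk_appendI[of _ _ w] awalk_appendI[of _ _ "tail G f"])
      (auto simp: m_def awalk_simps)
  have "\<not> prefix q (t @ q)" if t: "t \<in> B" for t
  proof
    assume "prefix q (t @ q)"
    then have nth: "q ! i = (t @ q) ! i" if "i \<le> N" for i
      using that len_q by (metis le_imp_less_Suc nth_append prefix_def)
    have "length t \<le> Max (length ` B)" using B(1) t by simp
    then have t_n: "length t < n" by (simp add: n_def)
    moreover have "n \<le> n * m" using m by simp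
    ultimately have "length t < n * m" by (rule less_le_trans)
    then have t_N: "length t < N" by (simp add: N_def)
    \<comment> \<open>position \<open>length t\<close> of \<open>t @ q\<close> is the beginning of \<open>q\<close>\<close>
    have "c ! (length t mod m) = c ! 0"
      using nth[of "length t"] t_N q_i[of "length t"] q_i[of 0] by (simp add: nth_append)
    then have "length t mod m = 0" using first[of "length t mod m"] m tail_hd by simp
    then obtain d where d: "length t = m * d" by auto
    moreover have "d \<le> m * d" using m by simp
    ultimately have "d \<le> n" using t_n by linarith
    then have "N - length t = (n - d) * m + j" by (simp add: N_def d algebra_simps diff_mult_distrib)
    then have "(N - length t) mod m = j" using j by simp
    moreover have "N - length t < N" using t B(2) t_N by (cases t) auto
    ultimately have "q ! (N - length t) = c ! j" using q_i by simp
    moreover have "q ! N = q ! (N - length t)" using nth[of N] t_N by (simp add: nth_append)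
    ultimately show False using q_N j by simp
  qed
  then show thesis using walk that by blast
qed

end

section \<open>Reduction to a vertex\<close>

context leavitt_family
begin

lemma sc_alg: "x \<in> alg \<Longrightarrow> sc a * x = x * sc a"
proof -
  assume "x \<in> alg"
  then obtain y where "x = eval y" by (auto simp: alg_def)
  moreover have "sc a * (sc b * word_value w) = sc b * word_value w * sc a" for b w
    by (metis mult.assoc mult.commute sc_mult sc_word_value)
  ultimately show ?thesis by (simp add: eval_def sum_distrib_left sum_distrib_right)
qed

text \<open>
  For a shortest path \<open>p0\<close> of the combination, multiplying by its ghost on the left keeps
  exactly the paths that extend \<open>p0\<close>, and turns each of them into the closed path \<open>t\<close> by which
  it does so; \<open>p0\<close> itself becomes a vertex. Then \<open>escaping_walk\<close> disposes of the
  non-trivial \<open>t\<close>.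
\<close>

lemma path_combination_reduces_to_vertex:
  assumes L: "condition_L E" and "path_combination w x"
  shows "\<exists>a\<in>alg. \<exists>b\<in>alg. \<exists>v\<in>verts E. a * x * b = P v"
proof -
  obtain A k where A: "finite A" "A \<noteq> {}" "\<forall>(u, p)\<in>A. awalk u p w \<and> k (u, p) \<noteq> 0"
    and x: "x = (\<Sum>(u, p)\<in>A. sc (k (u, p)) * path_elem u p)"
    using assms(2) unfolding path_combination_def by blast
  obtain r where "r \<in> A" "\<And>r'. r' \<in> A \<Longrightarrow> length (snd r) \<le> length (snd r')"
    using A(2) ex_has_least_nat[of "\<lambda>r. r \<in> A" _ "\<lambda>r. length (snd r)"] by blast
  then obtain u0 p0 where r: "(u0, p0) \<in> A" "\<And>u p. (u, p) \<in> A \<Longrightarrow> length p0 \<le> length p"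
    by (metis prod.collapse snd_conv)
  have w0: "awalk u0 p0 w" using A r by auto
  define B where "B = {t. (u0, p0 @ t) \<in> A \<and> t \<noteq> []}"
  have "B \<subseteq> (\<lambda>(u, p). drop (length p0) p) ` A" by (force simp: B_def)
  then have "finite B" using A(1) finite_surj by blast
  have B_walk: "awalk w t w" if "(u0, p0 @ t) \<in> A" for t
  proof -
    have "awalk u0 (p0 @ t) w" using A(3) that by auto
    then show ?thesis using w0 by auto
  qed
  obtain q w' where q: "awalk w q w'" "\<And>t. t \<in> B \<Longrightarrow> \<not> prefix q (t @ q)"
    using escaping_walk[OF L _ \<open>finite B\<close>, of w] B_walk awalk_verts(2)[OF w0]
    by (auto simp: B_def)
  let ?a = "ghost_elem w q * ghost_elem u0 p0"
  have term_val: "?a * path_elem u p * path_elem w q = (if (u, p) = (u0, p0) then P w' else 0)"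
    if up: "(u, p) \<in> A" for u p
  proof -
    have walk: "awalk u p w" using A(3) up by auto
    show ?thesis
    proof (cases "u = u0 \<and> prefix p0 p")
      case False
      then have "ghost_elem u0 p0 * path_elem u p = 0"
        using ghost_path[OF w0 walk r(2)[OF up]] by auto
      then show ?thesis using False by (auto simp: mult.assoc simp flip: mult.assoc[of "ghost_elem u0 p0"])
    next
      case True
      then obtain t where t: "p = p0 @ t" "u = u0" by (auto simp: prefix_def)
      have t_walk: "awalk w t w" using B_walk up t by simp
      have "ghost_elem u0 p0 * path_elem u p = path_elem w t"
        using ghost_path[OF w0 walk r(2)[OF up]] t by simp
      then have "?a * path_elem u p * path_elem w q = ghost_elem w q * (path_elem w t * path_elem w q)"
        by (metis mult.assoc)
      also have "\<dots> = ghost_elem w q * path_elem w (t @ q)"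
        using path_elem_append[OF t_walk q(1)] by simp
      also have "\<dots> = (if prefix q (t @ q) then path_elem w' (drop (length q) (t @ q)) else 0)"
        using ghost_path[OF q(1) awalk_appendI[OF t_walk q(1)]] by simp
      also have "\<dots> = (if t = [] then P w' else 0)"
        using q(2)[of t] up t by (auto simp: B_def)
      finally show ?thesis using t by simp
    qed
  qed
  have "?a * x * path_elem w q
      = (\<Sum>(u, p)\<in>A. sc (k (u, p)) * (?a * path_elem u p * path_elem w q))"
    unfolding x sum_distrib_left sum_distrib_right
  proof (rule sum.cong)
    fix r assume "r \<in> A"
    have "?a \<in> alg" using ghost_elem_in_alg[OF q(1)] ghost_elem_in_alg[OF w0] by (rule alg_closed)
    then have "?a * (sc (k r) * y) * z = sc (k r) * (?a * y * z)" for y z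
      by (metis mult.assoc sc_alg)
    then show "?a * (case r of (u, p) \<Rightarrow> sc (k (u, p)) * path_elem u p) * path_elem w q
      = (case r of (u, p) \<Rightarrow> sc (k (u, p)) * (?a * path_elem u p * path_elem w q))"
      by (cases r) simp
  qed simp
  also have "\<dots> = (\<Sum>r\<in>A. if r = (u0, p0) then sc (k r) * P w' else 0)"
    by (rule sum.cong) (use term_val in \<open>auto split: if_splits\<close>)
  also have "\<dots> = sc (k (u0, p0)) * P w'"
    using A(1) r(1) by (simp add: sum.delta)
  finally have "sc (inverse (k (u0, p0))) * ?a * x * path_elem w q
      = sc (inverse (k (u0, p0)) * k (u0, p0)) * P w'"
    by (simp add: mult.assoc sc_mult)
  moreover have "k (u0, p0) \<noteq> 0" using A r by auto
  ultimately have "sc (inverse (k (u0, p0))) * ?a * x * path_elem w q = P w'" by simp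
  moreover have "sc (inverse (k (u0, p0))) * ?a \<in> alg"
    using ghost_elem_in_alg[OF q(1)] ghost_elem_in_alg[OF w0] by (intro alg_closed)
  ultimately show ?thesis using path_elem_in_alg[OF q(1)] awalk_verts(2)[OF q(1)] by blast
qed

theorem reduction:
  assumes "condition_L E" "x \<in> alg" "x \<noteq> 0"
  obtains a b v where "a \<in> alg" "b \<in> alg" "v \<in> verts E" "a * x * b = P v"
proof -
  obtain n where "ghost_le n x" using assms(2) by (rule alg_ghost_le)
  then obtain y w where y: "y \<in> alg" "path_combination w (x * y)"
    using reduce_to_path_combination assms(3) by blast
  obtain a b v where "a \<in> alg" "b \<in> alg" "v \<in> verts E" "a * (x * y) * b = P v"
    using path_combination_reduces_to_vertex[OF assms(1) y(2)] by blast
  then show thesis using that[of a "y * b" v] y(1) by (auto simp: mult.assoc intro: alg_closed)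
qed

end

section \<open>Cycles without exits\<close>

text \<open>
  The corner at the base \<open>v\<close> of a cycle without exits, with \<open>C\<close> and \<open>D\<close> for
  \<open>c\<close> and \<open>c\<^sup>*\<close>. Laurent polynomials in \<open>C\<close> are avoided: every element of the corner
  becomes a polynomial in \<open>C\<close> after multiplication by a power of the invertible \<open>C\<close>.
\<close>

locale no_exit_cycle = leavitt_family E sc g
  for E :: "('v, 'e) pre_digraph" and sc :: "'k::field \<Rightarrow> 'r::ring_1" and g +
  fixes v c
  assumes c: "c \<noteq> []" "awalk v c v"
    and first_return: "e \<in> set (tl c) \<Longrightarrow> tail E e \<noteq> v"
    and no_exit: "e \<in> arcs E \<Longrightarrow> f \<in> set c \<Longrightarrow> tail E e = tail E f \<Longrightarrow> e = f"
begin

abbreviation "C \<equiv> path_elem v c"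
abbreviation "D \<equiv> ghost_elem v c"

lemma v: "v \<in> verts E" using c by auto

lemma PC [simp]: "P v * C = C" and CP [simp]: "C * P v = C" and PD [simp]: "D * P v = D"
  using c by (auto intro: P_path_elem path_elem_P ghost_elem_P)

text \<open>
  On a path without exits, each sum in \<open>cuntz_krieger_2\<close> has a single summand.
\<close>

lemma path_ghost_no_exit: "awalk u p w \<Longrightarrow> set p \<subseteq> set c \<Longrightarrow> path_elem u p * ghost_elem u p = P u"
proof (induction p arbitrary: u)
  case (Cons e p)
  have e: "e \<in> arcs E" "tail E e = u" "awalk (head E e) p w" using Cons.prems by (auto simp: awalk_simps)
  have "f = e" if "f \<in> arcs E" "tail E f = u" for f
    using no_exit[OF that(1), of e] that e Cons.prems by simp
  then have out: "out_arcs E u = {e}" using e unfolding out_arcs_def by blast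
  then have "regular_vertex E u" using e by (auto simp: regular_vertex_def)
  then have "S e * T e = P u" using cuntz_krieger_2[of u] out by simp
  moreover have "path_elem u (e # p) * ghost_elem u (e # p)
      = S e * (path_elem (head E e) p * ghost_elem (head E e) p) * T e"
    by (simp add: mult.assoc)
  ultimately show ?case using Cons.IH[OF e(3)] Cons.prems e by simp
qed (auto simp: awalk_simps)

lemma CD: "C * D = P v"
  using path_ghost_no_exit c by simp

lemma C_pow_D_pow: "P v * C ^ n * D ^ n = P v"
proof (induction n)
  case (Suc n)
  have "P v * C ^ Suc n * D ^ Suc n = P v * C ^ n * (C * D) * D ^ n"
    by (simp add: mult.assoc power_Suc2[of C] del: power_Suc) simp
  also have "\<dots> = P v * C ^ n * D ^ n"
  proof (cases n)
    case (Suc k)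
    have "C ^ n * P v = C ^ n" unfolding Suc power_Suc2 by (simp add: mult.assoc)
    then show ?thesis by (simp add: CD mult.assoc)
  qed (simp add: CD v)
  finally show ?case using Suc by simp
qed (simp add: v)

lemma walk_comparable_no_exit:
  "awalk u t w \<Longrightarrow> awalk u p w' \<Longrightarrow> set p \<subseteq> set c \<Longrightarrow> prefix t p \<or> prefix p t"
proof (induction t arbitrary: u p)
  case (Cons e t)
  show ?case
  proof (cases p)
    case (Cons f p')
    then have "e = f" using no_exit[of e f] Cons.prems by (auto simp: awalk_simps)
    then show ?thesis using Cons.IH[of "head E e" p'] Cons.prems Cons by (auto simp: awalk_simps)
  qed simp
qed simp

text \<open>
  Without exits there is only one way to continue from \<open>v\<close>, so a walk from \<open>v\<close> is
  comparable with \<open>c\<close> in the prefix order; a proper prefix does not end at \<open>v\<close>.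
\<close>

lemma closed_walk_power:
  "awalk v t v \<Longrightarrow> \<exists>n. t = concat (replicate n c)"
proof (induction "length t" arbitrary: t rule: less_induct)
  case less
  show ?case
  proof (cases "t = []")
    case True
    then show ?thesis by (intro exI[of _ 0]) simp
  next
    case False
    have "prefix c t"
    proof (rule ccontr)
      assume "\<not> prefix c t"
      then have "prefix t c" using walk_comparable_no_exit[OF less.prems c(2)] by simp
      then have t: "t = take (length t) c" "length t < length c"
        using \<open>\<not> prefix c t\<close>
        by (metis append_eq_conv_conj prefix_def,
            metis \<open>\<not> prefix c t\<close> append_eq_conv_conj linorder_not_less prefix_def take_all_iff)
      then have "awalk v t (tail E (c ! length t))"
        using awalk_take[OF c(2)] by metis
      then have "tail E (c ! length t) = v" using awalk_ends_eqD less.prems by blast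
      moreover have "c ! length t \<in> set (tl c)"
        using t(2) False by (cases c; cases t) (auto simp: nth_Cons')
      ultimately show False using first_return by blast
    qed
    then obtain t' where t': "t = c @ t'" by (auto simp: prefix_def)
    then have "awalk v t' v" using less.prems c by auto
    then obtain n where "t' = concat (replicate n c)" using less.hyps[of t'] t' c by auto
    then show ?thesis using t' by (intro exI[of _ "Suc n"]) simp
  qed
qed

lemma path_elem_power: "path_elem v (concat (replicate n c)) = P v * C ^ n"
proof (induction n)
  case (Suc n)
  have "path_elem v (concat (replicate (Suc n) c)) = C * (P v * C ^ n)"
    using path_elem_append[OF c(2) awalk_concat_replicate[OF c(2)]] Suc by simp
  then show ?case by (simp flip: mult.assoc)
qed simp

text \<open>
  Substitution of \<open>C\<close> for the indeterminate, with the vertex \<open>v\<close> as the value of \<open>1\<close>.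
  The factor \<open>P v\<close> is needed for the constant term, since \<open>C ^ 0\<close> is the identity of
  the ambient ring.
\<close>

definition peval :: "'k poly \<Rightarrow> 'r" where
  "peval p = (\<Sum>i\<le>degree p. sc (coeff p i) * (P v * C ^ i))"

lemma peval_bound: "degree p \<le> n \<Longrightarrow> peval p = (\<Sum>i\<le>n. sc (coeff p i) * (P v * C ^ i))"
  unfolding peval_def
  by (rule sum.mono_neutral_left) (auto simp: coeff_eq_0 not_le)

lemma peval_add: "peval (p + q) = peval p + peval q"
proof -
  let ?n = "max (degree p) (degree q)"
  have "degree (p + q) \<le> ?n" by (rule degree_add_le_max)
  then show ?thesis
    by (simp add: peval_bound[of _ ?n] sc_add distrib_right sum.distrib)
qed

lemma peval_smult: "peval (smult a p) = sc a * peval p"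
proof -
  have "degree (smult a p) \<le> degree p" by (rule degree_smult_le)
  then show ?thesis
    by (simp add: peval_bound[of _ "degree p"] sc_mult sum_distrib_left mult.assoc)
qed

lemma peval_0 [simp]: "peval 0 = 0" by (simp add: peval_def)

lemma peval_1: "peval 1 = P v" by (simp add: peval_def)

lemma C_in_alg: "C \<in> alg" using path_elem_in_alg c by blast

lemma peval_monom: "peval (monom a n) = sc a * (P v * C ^ n)"
proof -
  have "peval (monom a n) = (\<Sum>i\<le>n. sc (coeff (monom a n) i) * (P v * C ^ i))"
    by (rule peval_bound) (rule degree_monom_le)
  also have "\<dots> = (\<Sum>i\<le>n. if i = n then sc a * (P v * C ^ n) else 0)"
    by (rule sum.cong) auto
  finally show ?thesis by simp
qed

lemma peval_shift: "peval (pCons 0 p) = C * peval p"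
proof -
  have "degree (pCons 0 p) \<le> Suc (degree p)" by (rule degree_pCons_le)
  then have "peval (pCons 0 p) = (\<Sum>i\<le>Suc (degree p). sc (coeff (pCons 0 p) i) * (P v * C ^ i))"
    by (rule peval_bound)
  also have "\<dots> = (\<Sum>i\<le>degree p. sc (coeff p i) * (P v * C ^ Suc i))"
    by (simp add: sum.atMost_Suc_shift del: sum.atMost_Suc power_Suc)
  also have "\<dots> = (\<Sum>i\<le>degree p. C * (sc (coeff p i) * (P v * C ^ i)))"
  proof (rule sum.cong)
    fix i
    have "C * (sc (coeff p i) * (P v * C ^ i)) = sc (coeff p i) * (C * P v * C ^ i)"
      using sc_alg[OF C_in_alg] by (metis mult.assoc)
    then show "sc (coeff p i) * (P v * C ^ Suc i) = C * (sc (coeff p i) * (P v * C ^ i))"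
      by (simp add: mult.assoc[symmetric, of "P v"])
  qed simp
  finally show ?thesis by (simp add: peval_def sum_distrib_left)
qed

lemma P_peval: "P v * peval p = peval p"
proof -
  have "P v * (sc a * (P v * y)) = sc a * (P v * y)" for a y
    using sc_alg[of "P v"] v by (metis P_idem generators_in_alg(1) mult.assoc)
  then show ?thesis by (simp add: peval_def sum_distrib_left)
qed

lemma peval_mult: "peval (p * q) = peval p * peval q"
proof (induction p)
  case (pCons a p)
  have "peval (pCons a p) = sc a * P v + C * peval p"
    using peval_add[of "[:a:]" "pCons 0 p"] peval_shift[of p] peval_smult[of a 1]
    by (simp add: peval_1)
  moreover have "peval (pCons a p * q) = sc a * peval q + C * peval (p * q)"
    by (simp add: mult_pCons_left peval_add peval_smult peval_shift)
  ultimately show ?case using pCons by (simp add: distrib_right mult.assoc P_peval)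
qed simp

lemma peval_power: "peval (p ^ Suc n) = peval p ^ Suc n"
proof (induction n)
  case (Suc n)
  then show ?case using peval_mult[of p "p ^ Suc n"] by simp
qed simp

text \<open>
  A path \<open>q\<close> to \<open>v\<close> that is long enough absorbs all ghost edges of \<open>x\<close>; what remains are closed
  paths at \<open>v\<close>, which are powers of \<open>c\<close>. The start of \<open>q\<close> varies, because each ghost edge
  that is absorbed shortens \<open>q\<close>.
\<close>

lemma corner_peval:
  assumes "ghost_le n x" "awalk u q v" "n \<le> length q"
  shows "\<exists>p. P v * x * path_elem u q = peval p"
  using assms
proof (induction arbitrary: u q rule: ghost_le.induct)
  case (zero n)
  then show ?case by (intro exI[of _ 0]) simp
next
  case (add n x y)
  then obtain p p' where "P v * x * path_elem u q = peval p" "P v * y * path_elem u q = peval p'"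
    by blast
  then show ?case by (intro exI[of _ "p + p'"]) (simp add: peval_add distrib_left distrib_right)
next
  case (path u' p' w n d)
  have "P v * (sc d * path_elem u' p') * path_elem u q = sc d * (P v * path_elem u' p' * path_elem u q)"
    using sc_alg[of "P v"] v by (metis generators_in_alg(1) mult.assoc)
  moreover have "\<exists>p. sc d * (P v * path_elem u' p' * path_elem u q) = peval p"
  proof (cases "u' = v \<and> w = u")
    case True
    then have "awalk v (p' @ q) v" using path by (blast intro: awalk_appendI)
    then obtain m where m: "p' @ q = concat (replicate m c)" using closed_walk_power by blast
    have "P v * path_elem u' p' * path_elem u q = path_elem v (p' @ q)"
      using path True path_elem_append[of u' p' w q v] P_path_elem[of u' p' w] by auto
    then show ?thesis using m by (intro exI[of _ "monom d m"]) (simp add: peval_monom path_elem_power)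
  next
    case False
    have "P v * path_elem u' p' * path_elem u q = (P v * P u') * path_elem u' p' * (P w * P u) * path_elem u q"
      using P_path_elem[OF path(1)] path_elem_P[OF path(1)] P_path_elem[OF path(2)]
      by (metis mult.assoc)
    also have "\<dots> = 0"
      using False v awalk_verts[OF path(1)] awalk_verts[OF path(2)] by (auto simp: P_mult)
    finally show ?thesis by (intro exI[of _ 0]) simp
  qed
  ultimately show ?case by simp
next
  case (ghost n x e)
  then obtain f q' where q: "q = f # q'" by (cases q) auto
  have f: "f \<in> arcs E" "tail E f = u" "awalk (head E f) q' v" using ghost.prems by (auto simp: q awalk_simps)
  have "T e * path_elem u q = (if e = f then path_elem (head E f) q' else 0)"
    using f ghost.hyps P_path_elem[OF f(3)] by (auto simp: q T_S simp flip: mult.assoc)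
  then have *: "P v * (x * T e) * path_elem u q = (if e = f then P v * x * path_elem (head E f) q' else 0)"
    by (simp add: mult.assoc)
  show ?case
  proof (cases "e = f")
    case True
    then show ?thesis using * ghost.IH[OF f(3)] ghost.prems by (auto simp: q)
  next
    case False
    then show ?thesis using * by (intro exI[of _ 0]) simp
  qed
qed

lemma corner_polynomial:
  assumes "x \<in> alg"
  obtains n p where "P v * x * P v * C ^ n = peval p"
proof -
  obtain n where "ghost_le n x" using assms by (rule alg_ghost_le)
  moreover have "n \<le> length (concat (replicate n c))"
    using c by (cases c) (auto simp: length_concat_replicate)
  ultimately obtain p where "P v * x * path_elem v (concat (replicate n c)) = peval p"
    using corner_peval awalk_concat_replicate[OF c(2)] by blast
  then show thesis using that[of n p] by (simp add: path_elem_power mult.assoc)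
qed

lemma peval_witness: "peval [:1, -1:] = P v - C"
proof -
  have "[:1, -1:] = 1 + monom (-1 :: 'k) (Suc 0)"
    by (simp add: monom_Suc monom_0 one_pCons)
  then show ?thesis by (simp add: peval_add peval_1 peval_monom sc_uminus)
qed

lemma witness_not_nilpotent:
  assumes inj: "\<And>p. peval p = 0 \<Longrightarrow> p = 0"
  shows "(P v - C) ^ Suc n \<noteq> 0"
  using inj[of "[:1, -1:] ^ Suc n"] by (auto simp: peval_power peval_witness simp del: power_Suc)

text \<open>
  With \<open>f = e * P v\<close> and \<open>f * C ^ n = peval r\<close>, idempotence of \<open>f\<close> becomes
  \<open>r * r = r * X ^ n\<close>, so \<open>r = 0\<close> or \<open>r = X ^ n\<close>. The factor \<open>1 - X\<close> of \<open>r\<close>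
  forces \<open>r = 0\<close>. Then \<open>f = 0\<close>, as \<open>C\<close> is invertible in the corner, and
  \<open>e = e * P v * e = 0\<close>.
\<close>

lemma witness_no_idempotent:
  assumes inj: "\<And>p. peval p = 0 \<Longrightarrow> p = 0"
    and b: "b \<in> alg" and idem: "e * e = e" and e: "e = (P v - C) * b"
  shows "e = 0"
proof -
  obtain n q where q: "P v * b * P v * C ^ n = peval q" using b by (rule corner_polynomial)
  define r where "r = [:1, -1:] * q"
  have Pe: "P v * e = e" by (simp add: e right_diff_distrib v flip: mult.assoc)
  define f where "f = e * P v"
  have ff: "f * f = f" by (metis Pe f_def idem mult.assoc)
  have fP: "f * P v = f" by (simp add: f_def mult.assoc v)
  have a: "(P v - C) * P v = P v - C" by (simp add: left_diff_distrib v)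
  have fC: "f * C ^ n = peval r"
    unfolding r_def peval_mult peval_witness q[symmetric]
    unfolding f_def e using a by (metis mult.assoc)
  have x_n: "peval (monom 1 n) = P v * C ^ n" by (simp add: peval_monom)
  have "peval r * peval r = f * (P v * C ^ n) * peval r"
    using fC fP by (metis mult.assoc)
  also have "\<dots> = f * (peval r * (P v * C ^ n))"
    by (metis mult.assoc x_n peval_mult mult.commute)
  also have "\<dots> = f * (f * C ^ n * (P v * C ^ n))" by (simp add: fC)
  also have "\<dots> = peval r * (P v * C ^ n)" using ff fC by (metis mult.assoc)
  finally have "peval (r * r) = peval (r * monom 1 n)" by (simp add: peval_mult x_n)
  then have "peval (r * r - r * monom 1 n) = 0"
    using peval_add[of "r * r - r * monom 1 n" "r * monom 1 n"] by simp
  then have "r * r - r * monom 1 n = 0" by (rule inj)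
  then have "r * (r - monom 1 n) = 0" by (simp only: right_diff_distrib)
  moreover have "r \<noteq> monom 1 n"
  proof
    assume "r = monom 1 n"
    then have "poly r 1 = 1" by (simp add: poly_monom)
    then show False by (simp add: r_def)
  qed
  ultimately have "r = 0" by simp
  then have "f * (P v * C ^ n) * D ^ n = 0" using fC fP by (metis mult.assoc mult_zero_left peval_0)
  then have "f = 0" using C_pow_D_pow[of n] fP by (metis mult.assoc)
  then show ?thesis using Pe idem f_def by (metis mult.assoc mult_zero_left)
qed

end

section \<open>The boundary path representation\<close>

text \<open>
  A boundary path is an infinite path, or a finite path that ends at a vertex which is not regular.
  It is given by its start and its sequence of edges; \<^const>\<open>None\<close> marks the end, and the values
  after the first \<^const>\<open>None\<close> are irrelevant.
\<close>

coinductive boundary_path :: "('v, 'e) pre_digraph \<Rightarrow> 'v \<Rightarrow> (nat \<Rightarrow> 'e option) \<Rightarrow> bool" for E where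
  stop: "\<not> regular_vertex E v \<Longrightarrow> p 0 = None \<Longrightarrow> boundary_path E v p"
| step: "e \<in> arcs E \<Longrightarrow> tail E e = v \<Longrightarrow> p 0 = Some e \<Longrightarrow> boundary_path E (head E e) (p \<circ> Suc)
    \<Longrightarrow> boundary_path E v p"

lemma boundary_path_Some:
  "boundary_path E v p \<Longrightarrow> p 0 = Some e \<Longrightarrow>
     e \<in> arcs E \<and> tail E e = v \<and> boundary_path E (head E e) (p \<circ> Suc)"
  by (erule boundary_path.cases) auto

lemma boundary_path_regular:
  "boundary_path E v p \<Longrightarrow> regular_vertex E v \<Longrightarrow> \<exists>e\<in>out_arcs E v. p 0 = Some e"
  by (erule boundary_path.cases) (auto simp: out_arcs_def)

lemma boundary_path_Cons:
  "e \<in> arcs E \<Longrightarrow> boundary_path E (head E e) p \<Longrightarrow>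
     boundary_path E (tail E e) (case_nat (Some e) p)"
  by (rule boundary_path.step) (auto simp: comp_def)

lemma boundary_path_exists: "\<exists>p. boundary_path E v p"
proof -
  define choice where "choice u = (if regular_vertex E u then Some (SOME e. e \<in> out_arcs E u) else None)" for u
  define move where "move u = (case choice u of None \<Rightarrow> u | Some e \<Rightarrow> head E e)" for u
  have "boundary_path E v (\<lambda>n. choice ((move ^^ n) v))"
  proof (coinduction arbitrary: v)
    case boundary_path
    show ?case
    proof (cases "regular_vertex E v")
      case True
      define e where "e = (SOME e. e \<in> out_arcs E v)"
      have "e \<in> out_arcs E v"
        using True unfolding regular_vertex_def e_def by (metis some_in_eq)
      moreover have "choice v = Some e" using True by (simp add: choice_def e_def)
      ultimately show ?thesis
        by (auto simp: out_arcs_def move_def comp_def funpow_swap1 intro!: exI[of _ e] exI[of _ "head E e"])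
    next
      case False
      then show ?thesis by (auto simp: choice_def)
    qed
  qed
  then show ?thesis by blast
qed

text \<open>
  The integer is a degree, which the edges shift. It keeps the powers of a cycle apart, all of which
  fix the infinite path around the cycle.
\<close>

type_synonym ('v, 'e) boundary_point = "'v \<times> (nat \<Rightarrow> 'e option) \<times> int"

text \<open>
  Functions are moved along the shift maps of boundary paths and extended by zero. The relation at a
  regular vertex holds because every boundary path there begins with exactly one of the edges that
  the vertex emits.
\<close>

primrec boundary_act :: "('v, 'e) pre_digraph \<Rightarrow> ('v, 'e) lpa_gen \<Rightarrow>
    (('v, 'e) boundary_point \<Rightarrow> 'k::field) \<Rightarrow> ('v, 'e) boundary_point \<Rightarrow> 'k" where
  "boundary_act E (Vertex v) f = (\<lambda>(u, p, n).
     if u = v \<and> boundary_path E u p then f (u, p, n) else 0)"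
| "boundary_act E (Edge e) f = (\<lambda>(u, p, n).
     if boundary_path E u p \<and> p 0 = Some e then f (head E e, p \<circ> Suc, n - 1) else 0)"
| "boundary_act E (Ghost e) f = (\<lambda>(u, p, n).
     if u = head E e \<and> boundary_path E u p then f (tail E e, case_nat (Some e) p, n + 1) else 0)"

definition boundary_scale :: "'k::field \<Rightarrow> (('v, 'e) boundary_point \<Rightarrow> 'k) endo" where
  "boundary_scale c = Endo (\<lambda>f x. c * f x)"

definition boundary_gen :: "('v, 'e) pre_digraph \<Rightarrow> ('v, 'e) lpa_gen \<Rightarrow>
    (('v, 'e) boundary_point \<Rightarrow> 'k::field) endo" where
  "boundary_gen E l = Endo (boundary_act E l)"

lemma app_boundary_scale [simp]: "app (boundary_scale c) f x = c * f x"
  unfolding boundary_scale_def by (subst app_Endo) (auto simp: algebra_simps)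

lemma app_boundary_gen: "app (boundary_gen E l) f = boundary_act E l f"
  unfolding boundary_gen_def by (subst app_Endo) (cases l; auto simp: fun_eq_iff)+

lemma sum_fun_apply: "sum f A x = (\<Sum>i\<in>A. f i x)"
  by (induction A rule: infinite_finite_induct) auto

lemma case_nat_shift: "p 0 = Some e \<Longrightarrow> case_nat (Some e) (p \<circ> Suc) = p"
  by (auto simp: fun_eq_iff split: nat.split)

context wf_digraph
begin

lemma generator_assignment_boundary:
  "generator_assignment boundary_scale
     (boundary_gen G :: _ \<Rightarrow> (('a, 'b) boundary_point \<Rightarrow> 'k::field) endo)"
proof
  show "boundary_scale c * boundary_gen G l
      = (boundary_gen G l * boundary_scale c :: (('a, 'b) boundary_point \<Rightarrow> 'k) endo)" for c l
    by (intro endo_eqI ext) (cases l; auto simp: app_boundary_gen)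
qed (auto intro!: endo_eqI simp: fun_eq_iff algebra_simps)

lemma leavitt_family_boundary:
  "leavitt_family G boundary_scale
     (boundary_gen G :: _ \<Rightarrow> (('a, 'b) boundary_point \<Rightarrow> 'k::field) endo)"
proof -
  interpret generator_assignment boundary_scale
    "boundary_gen G :: _ \<Rightarrow> (('a, 'b) boundary_point \<Rightarrow> 'k) endo"
    by (rule generator_assignment_boundary)
  have "eval x = 0" if "x \<in> lpa_relators G" for x :: "('a, 'b) lpa_gen free_word \<Rightarrow>\<^sub>0 'k"
    using that
  proof cases
    case (regular v)
    have "(\<Sum>e\<in>out_arcs G v. app (boundary_gen G (Edge e)) (app (boundary_gen G (Ghost e)) f) (u, p, n))
       = app (boundary_gen G (Vertex v)) f (u, p, n)" for u p n and f :: "('a, 'b) boundary_point \<Rightarrow> 'k"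
    proof -
      have fin: "finite (out_arcs G v)" using regular by (simp add: regular_vertex_def)
      have "(\<Sum>e\<in>out_arcs G v. app (boundary_gen G (Edge e)) (app (boundary_gen G (Ghost e)) f) (u, p, n))
        = (\<Sum>e\<in>out_arcs G v. if boundary_path G u p \<and> p 0 = Some e then f (u, p, n) else 0)"
        by (rule sum.cong) (auto simp: app_boundary_gen case_nat_shift dest: boundary_path_Some)
      also have "\<dots> = (if u = v \<and> boundary_path G u p then f (u, p, n) else 0)"
      proof (cases "boundary_path G u p \<and> u = v")
        case True
        then obtain e where e: "e \<in> out_arcs G v" "p 0 = Some e"
          using boundary_path_regular[of G v p] regular(2) True by auto
        then have "(\<Sum>e\<in>out_arcs G v. if boundary_path G u p \<and> p 0 = Some e then f (u, p, n) else 0)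
          = (\<Sum>e'\<in>out_arcs G v. if e' = e then f (u, p, n) else 0)"
          using True by (intro sum.cong) auto
        then show ?thesis using e fin True by (auto simp: sum.delta)
      next
        case False
        then show ?thesis
          by (auto intro!: sum.neutral simp: out_arcs_def dest: boundary_path_Some)
      qed
      finally show ?thesis by (simp add: app_boundary_gen)
    qed
    then show ?thesis
      by (intro endo_eqI ext)
        (auto simp: regular eval_diff eval_sum eval_mult app_sum fun_eq_iff sum_fun_apply)
  qed (intro endo_eqI ext; auto simp: eval_diff eval_mult app_boundary_gen case_nat_shift
      comp_def[of "case_nat _ _"] boundary_path_Cons dest: boundary_path_Some)+
  then show ?thesis
    by (intro leavitt_family.intro leavitt_family_axioms.intro generator_assignment_boundary)
      unfold_locales
qed

lemma awalk_head_nth: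
  "awalk u p v \<Longrightarrow> i < length p \<Longrightarrow> head G (p ! i) = (if Suc i < length p then tail G (p ! Suc i) else v)"
proof (induction p arbitrary: u i)
  case (Cons e p)
  then show ?case
    by (cases i; cases p) (auto simp: awalk_simps)
qed simp

lemma boundary_path_cycle:
  assumes "awalk v c v" "c \<noteq> []"
  shows "boundary_path G v (\<lambda>i. Some (c ! (i mod length c)))"
proof -
  let ?m = "length c"
  have hd: "tail G (c ! 0) = v" using assms by (cases c) (auto simp: awalk_simps)
  have arcs: "c ! (i mod ?m) \<in> arcs G" for i
    using assms by (meson awalkE' length_greater_0_conv mod_less_divisor nth_mem subsetD)
  have step: "head G (c ! (i mod ?m)) = tail G (c ! (Suc i mod ?m))" for i
    using awalk_head_nth[OF assms(1), of "i mod ?m"] assms(2) hd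
      mod_less_divisor[of ?m i] by (auto simp: mod_Suc simp del: mod_less_divisor)
  have "boundary_path G (tail G (c ! (i mod ?m))) (\<lambda>j. Some (c ! ((i + j) mod ?m)))" for i
  proof (coinduction arbitrary: i)
    case boundary_path
    have "(\<lambda>j. Some (c ! ((i + j) mod ?m))) \<circ> Suc = (\<lambda>j. Some (c ! ((Suc i + j) mod ?m)))"
      by (simp add: comp_def)
    then show ?case using arcs[of i] step[of i] by (intro disjI2) (auto intro!: exI[of _ "Suc i"])
  qed
  from this[of 0] show ?thesis using hd by simp
qed

end

section \<open>Leavitt families that represent the algebra faithfully\<close>

text \<open>
  A Leavitt family generating a faithful copy of the Leavitt path algebra. Whatever vanishes
  in it vanishes in every Leavitt family, in particular in the boundary path representation.
\<close>

locale universal_leavitt_family = leavitt_family E sc g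
  for E :: "('v, 'e) pre_digraph" and sc :: "'k::field \<Rightarrow> 'r::ring_1" and g +
  assumes eval_eq_0_iff: "x \<in> carrier (free_rng (lpa_gens E)) \<Longrightarrow>
    eval x = 0 \<longleftrightarrow> x \<in> alg_ideal (lpa_gens E) (lpa_relators E)"
begin

sublocale boundary: leavitt_family E boundary_scale
  "boundary_gen E :: _ \<Rightarrow> (('v, 'e) boundary_point \<Rightarrow> 'k) endo"
  by (rule leavitt_family_boundary)

lemma eval_boundary:
  assumes "x \<in> carrier (free_rng (lpa_gens E))" "eval x = 0"
  shows "boundary.eval x = 0"
  using assms eval_eq_0_iff boundary.relators_vanish boundary.eval_alg_ideal by blast

lemma vertex_nonzero:
  assumes "v \<in> verts E"
  shows "P v \<noteq> 0"
proof
  assume "P v = 0"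
  then have "boundary.eval (gen (Vertex v)) = 0"
    using assms by (intro eval_boundary gen_mem_free_rng) (auto simp: lpa_gens_def)
  then have 0: "boundary_gen E (Vertex v) = (0 :: (('v, 'e) boundary_point \<Rightarrow> 'k) endo)" by simp
  obtain p where "boundary_path E v p" using boundary_path_exists[of E v] by blast
  then have "app (boundary_gen E (Vertex v)) (\<lambda>_. 1 :: 'k) (v, p, 0) = 1"
    by (simp add: app_boundary_gen)
  then show False unfolding 0 by simp
qed

end

lemma (in leavitt_family) path_elem_word:
  "awalk u p w \<Longrightarrow> path_elem u p = word_value (FWord (Vertex u # map Edge p))"
proof (induction p arbitrary: u)
  case (Cons e p)
  then have e: "e \<in> arcs E" "tail E e = u" "awalk (head E e) p w" by (auto simp: awalk_simps)
  have "path_elem u (e # p) = (S e * P (head E e)) * prod_list (map S p)"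
    using Cons.IH[OF e(3)] e(1) by (simp add: word_value_def mult.assoc comp_def del: S_P)
  also have "\<dots> = (P u * S e) * prod_list (map S p)" using e by auto
  finally show ?case by (simp add: word_value_def comp_def mult.assoc)
qed (simp add: word_value_def)

lemma (in wf_digraph) boundary_path_elem:
  fixes f :: "('a, 'b) boundary_point \<Rightarrow> 'k::field"
  assumes "awalk u q w" "boundary_path G u p" "\<And>i. i < length q \<Longrightarrow> p i = Some (q ! i)"
  shows "app (leavitt_family.path_elem G (boundary_gen G) u q) f (u, p, n)
    = f (w, \<lambda>i. p (i + length q), n - int (length q))"
proof -
  interpret leavitt_family G boundary_scale
    "boundary_gen G :: _ \<Rightarrow> (('a, 'b) boundary_point \<Rightarrow> 'k) endo"
    by (rule leavitt_family_boundary)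
  show ?thesis
    using assms
  proof (induction q arbitrary: u p n)
    case Nil
    then show ?case by (simp add: awalk_simps app_boundary_gen)
  next
    case (Cons e q)
    have e: "tail G e = u" "awalk (head G e) q w" using Cons.prems by (auto simp: awalk_simps)
    have p0: "p 0 = Some e" using Cons.prems(3)[of 0] by simp
    then have "boundary_path G (head G e) (p \<circ> Suc)" using Cons.prems(2) boundary_path_Some by metis
    then have "app (path_elem (head G e) q) f (head G e, p \<circ> Suc, n - 1)
      = f (w, \<lambda>i. (p \<circ> Suc) (i + length q), n - 1 - int (length q))"
      using Cons.prems(3)[of "Suc _"] by (intro Cons.IH e) (auto simp: comp_def)
    then show ?case using p0 Cons.prems(2) by (simp add: app_boundary_gen algebra_simps)
  qed
qed

text \<open>
  In the boundary path representation, the combination is applied to the indicator function of the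
  infinite path around \<open>c\<close> in degree \<open>0\<close>. The value at the same path in degree
  \<open>j * length c\<close> is \<open>k j\<close>.
\<close>

lemma (in universal_leavitt_family) cycle_powers_independent:
  assumes c: "awalk v c v" "c \<noteq> []"
    and "(\<Sum>i\<le>n. sc (k i) * path_elem v (concat (replicate i c))) = 0" and j: "j \<le> n"
  shows "k j = 0"
proof -
  let ?c = "\<lambda>i. concat (replicate i c)" and ?m = "length c"
  let ?w = "\<lambda>i. FWord (Vertex v # map Edge (?c i))"
  let ?x = "\<Sum>i\<le>n. Poly_Mapping.single (?w i) (k i)"
  have walk: "awalk v (?c i) v" for i using c by (intro awalk_concat_replicate)
  have "v \<in> verts E" using c by auto
  moreover have "set (?c i) \<subseteq> arcs E" for i by (rule awalkE'[OF walk[of i]])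
  ultimately have "?x \<in> carrier (free_rng (lpa_gens E))"
    by (intro sum_mem_free_rng) (force simp: free_rng_def lpa_gens_def)
  moreover have "eval ?x = 0"
    using assms(3) by (simp add: eval_sum eval_single path_elem_word[OF walk])
  ultimately have "boundary.eval ?x = 0" by (rule eval_boundary)
  then have zero: "(\<Sum>i\<le>n. boundary_scale (k i) * boundary.path_elem v (?c i)) = 0"
    by (simp add: boundary.eval_sum boundary.eval_single boundary.path_elem_word[OF walk])
  let ?p = "\<lambda>i. Some (c ! (i mod ?m))"
  define f :: "('v, 'e) boundary_point \<Rightarrow> 'k" where "f = (\<lambda>x. if x = (v, ?p, 0) then 1 else 0)"
  have val: "app (boundary.path_elem v (?c i)) f (v, ?p, int (j * ?m)) = (if i = j then 1 else 0)" for i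
  proof -
    have "app (boundary.path_elem v (?c i)) f (v, ?p, int (j * ?m))
        = f (v, \<lambda>l. ?p (l + length (?c i)), int (j * ?m) - int (length (?c i)))"
      by (intro boundary_path_elem walk boundary_path_cycle c)
        (simp add: length_concat_replicate nth_concat_replicate)
    also have "\<dots> = (if i = j then 1 else 0)"
      using c(2) by (auto simp: f_def length_concat_replicate simp flip: of_nat_mult)
    finally show ?thesis .
  qed
  have "0 = app (\<Sum>i\<le>n. boundary_scale (k i) * boundary.path_elem v (?c i)) f (v, ?p, int (j * ?m))"
    unfolding zero by simp
  also have "\<dots> = (\<Sum>i\<le>n. k i * app (boundary.path_elem v (?c i)) f (v, ?p, int (j * ?m)))"
    by (simp add: app_sum sum_fun_apply del: of_nat_mult)
  also have "\<dots> = (\<Sum>i\<le>n. if i = j then k i else 0)"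
    by (rule sum.cong) (simp_all add: val del: of_nat_mult)
  also have "\<dots> = k j" using j by simp
  finally show ?thesis by simp
qed

section \<open>Idempotents in one-sided ideals\<close>

context nonunital_ring
begin

lemma rng_r_null: "x \<in> carrier R \<Longrightarrow> x \<otimes> \<zero> = \<zero>"
  using rng_distrib_left[of \<zero> \<zero> x] rng_mult_closed[of x \<zero>] by simp

lemma rng_l_null: "x \<in> carrier R \<Longrightarrow> \<zero> \<otimes> x = \<zero>"
  using rng_distrib_right[of \<zero> \<zero> x] rng_mult_closed[of \<zero> x] by simp

lemma rng_r_minus: "x \<in> carrier R \<Longrightarrow> y \<in> carrier R \<Longrightarrow> x \<otimes> (\<ominus> y) = \<ominus> (x \<otimes> y)"
  using rng_distrib_left[of "\<ominus> y" y x] rng_mult_closed[of x]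
  by (intro minus_equality[symmetric]) (auto simp: l_neg rng_r_null)

lemma weak_inverse_idempotents:
  assumes "a \<in> carrier R" "b \<in> carrier R" "b \<noteq> \<zero>" "b \<otimes> a \<otimes> b = b"
  shows "idempotent_elem R (a \<otimes> b)" "a \<otimes> b \<noteq> \<zero>" "idempotent_elem R (b \<otimes> a)" "b \<otimes> a \<noteq> \<zero>"
proof -
  note [simp] = assms(1,2) rng_mult_closed
  have "(a \<otimes> b) \<otimes> (a \<otimes> b) = a \<otimes> (b \<otimes> a \<otimes> b)" "(b \<otimes> a) \<otimes> (b \<otimes> a) = (b \<otimes> a \<otimes> b) \<otimes> a"
    by (simp_all add: rng_mult_assoc)
  then show "idempotent_elem R (a \<otimes> b)" "idempotent_elem R (b \<otimes> a)"
    by (simp_all add: idempotent_elem_def assms(4))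
  show "a \<otimes> b \<noteq> \<zero>" using assms(3,4) rng_r_null[of b] by (auto simp: rng_mult_assoc)
  show "b \<otimes> a \<noteq> \<zero>" using assms(3,4) rng_l_null[of b] by auto
qed

lemma ideals_contain_idempotents:
  assumes "\<forall>a\<in>carrier R. a \<noteq> \<zero> \<longrightarrow> (\<exists>b\<in>carrier R. b \<noteq> \<zero> \<and> b \<otimes> a \<otimes> b = b)"
  shows "right_ideal I R \<Longrightarrow> I \<noteq> {\<zero>} \<Longrightarrow> \<exists>x\<in>I. idempotent_elem R x \<and> x \<noteq> \<zero>"
    and "left_ideal I R \<Longrightarrow> I \<noteq> {\<zero>} \<Longrightarrow> \<exists>x\<in>I. idempotent_elem R x \<and> x \<noteq> \<zero>"
proof -
  have nonzero: "\<exists>a\<in>I. a \<in> carrier R \<and> a \<noteq> \<zero>" if "additive_subgroup I R" "I \<noteq> {\<zero>}"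
    using that additive_subgroup.zero_closed[OF that(1)] additive_subgroup.a_Hcarr[OF that(1)] by blast
  show "\<exists>x\<in>I. idempotent_elem R x \<and> x \<noteq> \<zero>" if I: "right_ideal I R" "I \<noteq> {\<zero>}"
  proof -
    interpret right_ideal I R by fact
    obtain a where a: "a \<in> I" "a \<in> carrier R" "a \<noteq> \<zero>"
      using nonzero I additive_subgroup_axioms by blast
    then obtain b where "b \<in> carrier R" "b \<noteq> \<zero>" "b \<otimes> a \<otimes> b = b" using assms by blast
    then show ?thesis using weak_inverse_idempotents[of a b] a right_ideal_closed by blast
  qed
  show "\<exists>x\<in>I. idempotent_elem R x \<and> x \<noteq> \<zero>" if I: "left_ideal I R" "I \<noteq> {\<zero>}"
  proof -
    interpret left_ideal I R by fact
    obtain a where a: "a \<in> I" "a \<in> carrier R" "a \<noteq> \<zero>"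
      using nonzero I additive_subgroup_axioms by blast
    then obtain b where "b \<in> carrier R" "b \<noteq> \<zero>" "b \<otimes> a \<otimes> b = b" using assms by blast
    then show ?thesis using weak_inverse_idempotents[of a b] a left_ideal_closed by blast
  qed
qed

lemma right_ideal_multiples:
  assumes a: "a \<in> carrier R"
  shows "right_ideal ((\<otimes>) a ` carrier R) R"
proof (intro right_ideal.intro right_ideal_axioms.intro additive_subgroup.intro add.subgroupI)
  fix x assume x: "x \<in> (\<otimes>) a ` carrier R"
  then obtain y where y: "y \<in> carrier R" "x = a \<otimes> y" by blast
  show "\<ominus> x \<in> (\<otimes>) a ` carrier R"
    unfolding y(2) rng_r_minus[OF a y(1), symmetric] using y(1) by simp
  show "x \<otimes> z \<in> (\<otimes>) a ` carrier R" if "z \<in> carrier R" for z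
    unfolding y(2) rng_mult_assoc[OF a y(1) that] using y(1) that by (simp add: rng_mult_closed)
  show "x \<oplus> x' \<in> (\<otimes>) a ` carrier R" if "x' \<in> (\<otimes>) a ` carrier R" for x'
    using that y a by (auto simp flip: rng_distrib_left)
qed (use a in \<open>auto simp: rng_mult_closed\<close>)

text \<open>
  If \<open>a \<otimes> a = \<zero>\<close> then \<open>a\<close> is nilpotent; otherwise \<open>a \<otimes> a\<close> witnesses that the right ideal
  of the multiples of \<open>a\<close> is non-zero.
\<close>

lemma zorn_ring_if_right_ideals:
  assumes "\<And>I. right_ideal I R \<Longrightarrow> I \<noteq> {\<zero>} \<Longrightarrow> \<exists>x\<in>I. idempotent_elem R x \<and> x \<noteq> \<zero>"
  shows "zorn_ring R"
proof (intro zorn_ring.intro zorn_ring_axioms.intro nonunital_ring_axioms)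
  fix a assume a: "a \<in> carrier R"
  show "nilpotent_elem R a \<or> (\<exists>b\<in>carrier R. idempotent_elem R (a \<otimes> b) \<and> a \<otimes> b \<noteq> \<zero>)"
  proof (cases "a \<otimes> a = \<zero>")
    case True
    then have "pow_Suc R a 1 = \<zero>" by simp
    then show ?thesis using a unfolding nilpotent_elem_def by blast
  next
    case False
    then have "(\<otimes>) a ` carrier R \<noteq> {\<zero>}" using a by blast
    then show ?thesis using assms[OF right_ideal_multiples[OF a]] by blast
  qed
qed

end

section \<open>The Zorn property and Condition (L)\<close>

context universal_leavitt_family
begin

abbreviation "FR \<equiv> free_rng (lpa_gens E) :: (('v, 'e) lpa_gen free_word \<Rightarrow>\<^sub>0 'k) ring"
abbreviation "L \<equiv> leavitt_path_algebra TYPE('k) E"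

text \<open>
  The cosets modulo the ideal of relations are the fibres of \<open>eval\<close>. Hence \<open>coset_of\<close> is
  the isomorphism from the algebra generated by the family to the Leavitt path algebra.
\<close>

definition coset_of :: "'r \<Rightarrow> (('v, 'e) lpa_gen free_word \<Rightarrow>\<^sub>0 'k) set" where
  "coset_of r = {x \<in> carrier FR. eval x = r}"

lemma coset_of_eval:
  assumes "x \<in> carrier FR"
  shows "alg_ideal (lpa_gens E) (lpa_relators E) +>\<^bsub>FR\<^esub> x = coset_of (eval x)"
proof (intro equalityI subsetI)
  fix z assume "z \<in> alg_ideal (lpa_gens E) (lpa_relators E) +>\<^bsub>FR\<^esub> x"
  then obtain i where i: "i \<in> alg_ideal (lpa_gens E) (lpa_relators E)" "z = i + x"
    by (auto simp: a_r_coset_def')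
  then have "i \<in> carrier FR" using alg_ideal_subset[OF lpa_relators_subset[OF wf_digraph_axioms]] by blast
  then show "z \<in> coset_of (eval x)"
    using i assms eval_eq_0_iff by (auto simp: coset_of_def eval_add intro: plus_mem_free_rng)
next
  fix z assume "z \<in> coset_of (eval x)"
  then have z: "z \<in> carrier FR" "eval z = eval x" by (auto simp: coset_of_def)
  then have "z - x \<in> alg_ideal (lpa_gens E) (lpa_relators E)"
    using eval_eq_0_iff[of "z - x"] assms by (simp add: eval_diff diff_mem_free_rng)
  then show "z \<in> alg_ideal (lpa_gens E) (lpa_relators E) +>\<^bsub>FR\<^esub> x"
    by (auto simp: a_r_coset_def' intro!: bexI[of _ "z - x"])
qed

lemma carrier_L: "carrier L = coset_of ` alg"
  unfolding leavitt_path_algebra_def FactRing_def A_RCOSETS_def' alg_def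
  by (auto simp: coset_of_eval)

lemma coset_of_nonempty: "r \<in> alg \<Longrightarrow> \<exists>x. x \<in> coset_of r"
  by (auto simp: alg_def coset_of_def)

lemma coset_of_inj: "r \<in> alg \<Longrightarrow> coset_of r = coset_of s \<longleftrightarrow> r = s"
  using coset_of_nonempty[of r] by (auto simp: coset_of_def)

lemma zero_L: "\<zero>\<^bsub>L\<^esub> = coset_of 0"
proof -
  have "alg_ideal (lpa_gens E) (lpa_relators E) = coset_of 0"
    using alg_ideal_subset[OF lpa_relators_subset[OF wf_digraph_axioms]] eval_eq_0_iff
    by (auto simp: coset_of_def)
  then show ?thesis by (simp add: leavitt_path_algebra_def FactRing_def)
qed

lemma mult_L:
  assumes "r \<in> alg" "s \<in> alg"
  shows "coset_of r \<otimes>\<^bsub>L\<^esub> coset_of s = coset_of (r * s)"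
proof -
  have "coset_of r \<otimes>\<^bsub>L\<^esub> coset_of s = (\<Union>a\<in>coset_of r. \<Union>b\<in>coset_of s. coset_of (r * s))"
    unfolding leavitt_path_algebra_def FactRing_def rcoset_mult_def
    by (auto simp: coset_of_eval mult_mem_free_rng eval_mult coset_of_def)
  then show ?thesis using coset_of_nonempty assms by auto
qed

lemma pow_Suc_L: "r \<in> alg \<Longrightarrow> pow_Suc L (coset_of r) n = coset_of (r ^ Suc n) \<and> r ^ Suc n \<in> alg"
  by (induction n) (auto simp: mult_L power_Suc2 simp del: power_Suc intro: alg_closed)

text \<open>
  If \<open>x r y\<close> is the vertex \<open>v\<close>, then \<open>y v x\<close> is a weak inverse of \<open>r\<close>. It is not zero
  because \<open>x r (y v x) r y = v\<close>.
\<close>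

lemma weak_inverses_if_condition_L:
  assumes L: "condition_L E" and a: "a \<in> carrier L" "a \<noteq> \<zero>\<^bsub>L\<^esub>"
  shows "\<exists>b\<in>carrier L. b \<noteq> \<zero>\<^bsub>L\<^esub> \<and> b \<otimes>\<^bsub>L\<^esub> a \<otimes>\<^bsub>L\<^esub> b = b"
proof -
  obtain r where r: "r \<in> alg" "a = coset_of r" using a by (auto simp: carrier_L)
  then have "r \<noteq> 0" using a by (auto simp: zero_L)
  then obtain x y v where xy: "x \<in> alg" "y \<in> alg" "v \<in> verts E" "x * r * y = P v"
    using reduction[OF L r(1)] by metis
  let ?b = "y * P v * x"
  have b: "?b \<in> alg" using xy by (intro alg_closed) auto
  have "?b * r * ?b = y * P v * (x * r * y) * P v * x" by (simp add: mult.assoc)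
  also have "\<dots> = ?b" using xy by (simp add: mult.assoc)
  finally have brb: "?b * r * ?b = ?b" .
  have "x * r * ?b * r * y = (x * r * y) * P v * (x * r * y)" by (simp add: mult.assoc)
  also have "\<dots> = P v" using xy by simp
  finally have "?b \<noteq> 0" using vertex_nonzero[OF xy(3)] by auto
  then have "coset_of ?b \<noteq> \<zero>\<^bsub>L\<^esub>" using coset_of_inj[OF b] by (simp add: zero_L)
  moreover have "coset_of ?b \<otimes>\<^bsub>L\<^esub> a \<otimes>\<^bsub>L\<^esub> coset_of ?b = coset_of ?b"
    using mult_L[OF alg_closed(4)[OF b r(1)] b] by (simp only: r(2) mult_L[OF b r(1)] brb)
  ultimately show ?thesis using b by (auto simp: carrier_L)
qed

lemma condition_L_if_zorn_ring:
  assumes "zorn_ring L"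
  shows "condition_L E"
proof (rule ccontr)
  interpret zorn_ring L by fact
  assume "\<not> condition_L E"
  then obtain c where scp: "simple_closed_path E c" and no_exit: "\<And>e. \<not> is_exit E e c"
    by (auto simp: condition_L_def)
  then obtain v where c: "c \<noteq> []" "awalk v c v"
    and first: "\<And>e. e \<in> set (tl c) \<Longrightarrow> tail E e \<noteq> tail E (hd c)"
    unfolding simple_closed_path_def by blast
  have v: "tail E (hd c) = v" using c by (cases c) (auto simp: awalk_simps)
  interpret N: no_exit_cycle E sc g v c
  proof
    show "e = f" if "e \<in> arcs E" "f \<in> set c" "tail E e = tail E f" for e f
      using no_exit[of e] that by (auto simp: is_exit_def)
  qed (use c first v in auto)
  have inj: "p = 0" if "N.peval p = 0" for p
  proof (rule poly_eqI)
    fix j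
    have "(\<Sum>i\<le>degree p. sc (coeff p i) * path_elem v (concat (replicate i c))) = 0"
      using that by (simp add: N.peval_def N.path_elem_power)
    then have "coeff p j = 0" if "j \<le> degree p"
      using cycle_powers_independent[OF c(2,1) _ that] by blast
    then show "coeff p j = coeff 0 j" by (cases "j \<le> degree p") (auto simp: coeff_eq_0)
  qed
  let ?a = "P v - N.C"
  have a: "?a \<in> alg" using N.v N.C_in_alg by (intro alg_closed) auto
  then have "coset_of ?a \<in> carrier L" by (simp add: carrier_L)
  then consider "nilpotent_elem L (coset_of ?a)"
    | b where "b \<in> carrier L" "idempotent_elem L (coset_of ?a \<otimes>\<^bsub>L\<^esub> b)"
        "coset_of ?a \<otimes>\<^bsub>L\<^esub> b \<noteq> \<zero>\<^bsub>L\<^esub>"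
    using zorn by blast
  then show False
  proof cases
    case 1
    then obtain n where "pow_Suc L (coset_of ?a) n = \<zero>\<^bsub>L\<^esub>" by (auto simp: nilpotent_elem_def)
    then have "?a ^ Suc n = 0" using pow_Suc_L[OF a, of n] coset_of_inj by (simp add: zero_L)
    then show False using N.witness_not_nilpotent[OF inj] by blast
  next
    case 2
    then obtain s where s: "s \<in> alg" "b = coset_of s" by (auto simp: carrier_L)
    have as: "?a * s \<in> alg" using a s(1) by (rule alg_closed)
    have "coset_of (?a * s * (?a * s)) = coset_of (?a * s)"
      using 2(2) by (simp only: s(2) idempotent_elem_def mult_L[OF a s(1)] mult_L[OF as as])
    then have "?a * s * (?a * s) = ?a * s" using coset_of_inj[OF alg_closed(4)[OF as as]] by blast
    then have "?a * s = 0" using N.witness_no_idempotent[OF inj s(1)] by blast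
    then show False using 2(3) by (simp only: s(2) mult_L[OF a s(1)] zero_L)
  qed
qed

end

text \<open>
  The regular representation is the required family.
\<close>

lemma universal_leavitt_family_exists:
  assumes "wf_digraph (E :: ('v, 'e) pre_digraph)"
  obtains sc :: "'k::field \<Rightarrow> (('v, 'e) lpa_gen free_word \<Rightarrow>\<^sub>0 'k) endo" and g
  where "universal_leavitt_family E sc g"
proof -
  interpret wf_digraph E by fact
  obtain sc :: "'k \<Rightarrow> (('v, 'e) lpa_gen free_word \<Rightarrow>\<^sub>0 'k) endo" and g
    where sc: "generator_assignment sc g"
      and ev: "\<And>x. x \<in> carrier (free_rng (lpa_gens E)) \<Longrightarrow>
        generator_assignment.eval sc g x = 0 \<longleftrightarrow> x \<in> alg_ideal (lpa_gens E) (lpa_relators E)"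
    using quotient_embeds_in_endo[OF lpa_relators_subset[OF assms]] by blast
  interpret generator_assignment sc g by fact
  have "universal_leavitt_family E sc g"
  proof
    show "eval x = 0" if "x \<in> lpa_relators E" for x
      using that ev lpa_relators_subset[OF assms] alg_ideal.base by blast
  qed (rule ev)
  then show thesis by (rule that)
qed

theorem theorem1:
  fixes E :: "('v, 'e) pre_digraph"
  assumes "wf_digraph E"
  defines "L \<equiv> leavitt_path_algebra TYPE('k::field) E"
  shows
    "(zorn_ring L \<longleftrightarrow>
        ((\<forall>I. right_ideal I L \<and> I \<noteq> {\<zero>\<^bsub>L\<^esub>} \<longrightarrow> (\<exists>x\<in>I. idempotent_elem L x \<and> x \<noteq> \<zero>\<^bsub>L\<^esub>)) \<and>
         (\<forall>I. left_ideal I L \<and> I \<noteq> {\<zero>\<^bsub>L\<^esub>} \<longrightarrow> (\<exists>x\<in>I. idempotent_elem L x \<and> x \<noteq> \<zero>\<^bsub>L\<^esub>)))) \<and>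
     (zorn_ring L \<longleftrightarrow>
        (\<forall>a\<in>carrier L. a \<noteq> \<zero>\<^bsub>L\<^esub> \<longrightarrow>
           (\<exists>b\<in>carrier L. b \<noteq> \<zero>\<^bsub>L\<^esub> \<and> b \<otimes>\<^bsub>L\<^esub> a \<otimes>\<^bsub>L\<^esub> b = b))) \<and>
     (zorn_ring L \<longleftrightarrow> condition_L E)"
proof -
  obtain sc :: "'k \<Rightarrow> (('v, 'e) lpa_gen free_word \<Rightarrow>\<^sub>0 'k) endo" and g
    where "universal_leavitt_family E sc g"
    using universal_leavitt_family_exists[OF assms(1)] by blast
  then interpret U: universal_leavitt_family E sc g .
  interpret nonunital_ring L
    unfolding L_def by (rule nonunital_ring_leavitt_path_algebra) fact
  let ?ii = "(\<forall>I. right_ideal I L \<and> I \<noteq> {\<zero>\<^bsub>L\<^esub>} \<longrightarrow> (\<exists>x\<in>I. idempotent_elem L x \<and> x \<noteq> \<zero>\<^bsub>L\<^esub>)) \<and>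
         (\<forall>I. left_ideal I L \<and> I \<noteq> {\<zero>\<^bsub>L\<^esub>} \<longrightarrow> (\<exists>x\<in>I. idempotent_elem L x \<and> x \<noteq> \<zero>\<^bsub>L\<^esub>))"
  let ?iii = "\<forall>a\<in>carrier L. a \<noteq> \<zero>\<^bsub>L\<^esub> \<longrightarrow>
           (\<exists>b\<in>carrier L. b \<noteq> \<zero>\<^bsub>L\<^esub> \<and> b \<otimes>\<^bsub>L\<^esub> a \<otimes>\<^bsub>L\<^esub> b = b)"
  have "condition_L E" if "zorn_ring L"
    using U.condition_L_if_zorn_ring that unfolding L_def .
  moreover have ?iii if "condition_L E"
    using U.weak_inverses_if_condition_L[OF that] unfolding L_def by blast
  moreover have ?ii if ?iii
    using ideals_contain_idempotents[OF that] by blast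
  moreover have "zorn_ring L" if ?ii
    using that by (intro zorn_ring_if_right_ideals) blast
  ultimately show ?thesis by blast
qed

end
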